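(* Let $s(7,n)$ be the number of spanning trees of the $7\times n$ grid graph $G_7(n)$ for $n\ge 1$, and let $s(7,0)=0$. Then, as formal power series in $t$, $$\sum_{n=0}^{\infty} s(7,n)\,t^n=\frac{N_7(t)}{D_7(t)},$$ where $$ \begin{aligned} N_7 ={}& -t^{47}-142\,t^{46}+661245\,t^{45}-279917500\,t^{44}+53184503243\,t^{43}-5570891154842\,t^{42}\\ &+341638600598298\,t^{41}-11886702497030032\,t^{40}+164458937576610742\,t^{39}\\ &+4371158470492451828\,t^{38}-288737344956855301342\,t^{37}+7736513993329973661368\,t^{36}\\ &-131582338768322853956994\,t^{35}+1573202877300834187134466\,t^{34}\\ &-13805721749199518460916737\,t^{33}+90975567796174070740787232\,t^{32}\\ &-455915282590547643587452175\,t^{31}+1747901867578637315747826286\,t^{30}\\ &-5126323837327170557921412877\,t^{29}+11416779122947828869806142972\,t^{28}\\ &-18924703166237080216745900796\,t^{27}+22194247945745188489023284104\,t^{26}\\ &-15563815847174688069871470516\,t^{25}+15563815847174688069871470516\,t^{23}\\ &-22194247945745188489023284104\,t^{22}+18924703166237080216745900796\,t^{21}\\ &-11416779122947828869806142972\,t^{20}+5126323837327170557921412877\,t^{19}\\ &-1747901867578637315747826286\,t^{18}+455915282590547643587452175\,t^{17}\\ &-90975567796174070740787232\,t^{16}+13805721749199518460916737\,t^{15}\\ &-1573202877300834187134466\,t^{14}+131582338768322853956994\,t^{13}-7736513993329973661368\,t^{12}\\ &+288737344956855301342\,t^{11}-4371158470492451828\,t^{10}-164458937576610742\,t^{9}\\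 &+11886702497030032\,t^{8}-341638600598298\,t^{7}+5570891154842\,t^{6}-53184503243\,t^{5}\\ &+279917500\,t^{4}-661245\,t^{3}+142\,t^{2}+t \end{aligned} $$ and $$ \begin{aligned} D_7 ={}& t^{48}-2769\,t^{47}+2630641\,t^{46}-1195782497\,t^{45}+305993127089\,t^{44}-48551559344145\,t^{43}\\ &+5083730101530753\,t^{42}-366971376492201338\,t^{41}+18871718211768417242\,t^{40}\\ &-709234610141846974874\,t^{39}+19874722637854592209338\,t^{38}-422023241997789381263002\,t^{37}\\ &+6880098547452856483997402\,t^{36}-87057778313447181201990522\,t^{35}\\ &+862879164715733847737203343\,t^{34}-6750900711491569851736413311\,t^{33}\\ &+41958615314622858303912597215\,t^{32}-208258356862493902206466194607\,t^{31}\\ &+828959040281722890327985220255\,t^{30}-2654944041424536277948746010303\,t^{29}\\ &+6859440538554030239641036025103\,t^{28}-14324708604336971207868317957868\,t^{27}\\ &+24214587194571650834572683444012\,t^{26}-33166490975387358866518005011884\,t^{25}\\ &+36830850383375837481096026357868\,t^{24}-33166490975387358866518005011884\,t^{23}\\ &+24214587194571650834572683444012\,t^{22}-14324708604336971207868317957868\,t^{21}\\ &+6859440538554030239641036025103\,t^{20}-2654944041424536277948746010303\,t^{19}\\ &+828959040281722890327985220255\,t^{18}-208258356862493902206466194607\,t^{17}\\ &+41958615314622858303912597215\,t^{16}-6750900711491569851736413311\,t^{15}\\ &+862879164715733847737203343\,t^{14}-87057778313447181201990522\,t^{13}\\ &+6880098547452856483997402\,t^{12}-422023241997789381263002\,t^{11}\\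 &+19874722637854592209338\,t^{10}-709234610141846974874\,t^{9}+18871718211768417242\,t^{8}\\ &-366971376492201338\,t^{7}+5083730101530753\,t^{6}-48551559344145\,t^{5}+305993127089\,t^{4}\\ &-1195782497\,t^{3}+2630641\,t^{2}-2769\,t+1. \end{aligned} $$
   Context: For positive integers $k,n$, the $k\times n$ grid graph $G_k(n)$ has vertex set $\{v_{ij} : 1\le i\le k,\ 1\le j\le n\}$, and $\{v_{ij},v_{i'j'}\}$ is an edge if and only if $|i-i'|+|j-j'|=1$. A spanning tree of a graph is a subset of its edges forming a tree on all of its vertices (labeled count, no identification under symmetry). *)

theory Defs
  imports "HOL-Computational_Algebra.Formal_Power_Series"
begin

(* Finite simple graphs are given by a vertex set V and a set E of two-element vertex sets. *)

definition simple_graph :: "'a set \<Rightarrow> 'a set set \<Rightarrow> bool" where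
  "simple_graph V E \<longleftrightarrow> finite V \<and> (\<forall>e\<in>E. e \<subseteq> V \<and> card e = 2)"

definition graph_connected :: "'a set \<Rightarrow> 'a set set \<Rightarrow> bool" where
  "graph_connected V E \<longleftrightarrow>
     V \<noteq> {} \<and> (\<forall>u\<in>V. \<forall>v\<in>V. (u, v) \<in> {(x, y). {x, y} \<in> E}\<^sup>*)"

(* A cycle is listed without repeating its first vertex at the end. *)
definition graph_cycle :: "'a set set \<Rightarrow> 'a list \<Rightarrow> bool" where
  "graph_cycle E p \<longleftrightarrow> length p \<ge> 3 \<and> distinct p \<and>
     (\<forall>i. Suc i < length p \<longrightarrow> {p ! i, p ! Suc i} \<in> E) \<and> {last p, hd p} \<in> E"

definition is_tree :: "'a set \<Rightarrow> 'a set set \<Rightarrow> bool" where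
  "is_tree V E \<longleftrightarrow> simple_graph V E \<and> graph_connected V E \<and> (\<nexists>p. graph_cycle E p)"

definition spanning_trees :: "'a set \<Rightarrow> 'a set set \<Rightarrow> 'a set set set" where
  "spanning_trees V E = {T. T \<subseteq> E \<and> is_tree V T}"

definition grid_verts :: "nat \<Rightarrow> nat \<Rightarrow> (nat \<times> nat) set" where
  "grid_verts k n = {1..k} \<times> {1..n}"

definition grid_edges :: "nat \<Rightarrow> nat \<Rightarrow> (nat \<times> nat) set set" where
  "grid_edges k n = {{(i, j), (i', j')} | i j i' j'.
     (i, j) \<in> grid_verts k n \<and> (i', j') \<in> grid_verts k n \<and>
     \<bar>int i - int i'\<bar> + \<bar>int j - int j'\<bar> = 1}"

definition s_grid :: "nat \<Rightarrow> nat \<Rightarrow> nat" where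
  "s_grid k n = (if n = 0 then 0 else card (spanning_trees (grid_verts k n) (grid_edges k n)))"

definition N7 :: "'a::comm_ring_1 \<Rightarrow> 'a" where
  "N7 t =
    - (t^47) - 142 * t^46 + 661245 * t^45 - 279917500 * t^44 + 53184503243 * t^43
     - 5570891154842 * t^42 + 341638600598298 * t^41 - 11886702497030032 * t^40
     + 164458937576610742 * t^39 + 4371158470492451828 * t^38 - 288737344956855301342 * t^37
     + 7736513993329973661368 * t^36 - 131582338768322853956994 * t^35
     + 1573202877300834187134466 * t^34 - 13805721749199518460916737 * t^33
     + 90975567796174070740787232 * t^32 - 455915282590547643587452175 * t^31
     + 1747901867578637315747826286 * t^30 - 5126323837327170557921412877 * t^29
     + 11416779122947828869806142972 * t^28 - 18924703166237080216745900796 * t^27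
     + 22194247945745188489023284104 * t^26 - 15563815847174688069871470516 * t^25
     + 15563815847174688069871470516 * t^23 - 22194247945745188489023284104 * t^22
     + 18924703166237080216745900796 * t^21 - 11416779122947828869806142972 * t^20
     + 5126323837327170557921412877 * t^19 - 1747901867578637315747826286 * t^18
     + 455915282590547643587452175 * t^17 - 90975567796174070740787232 * t^16
     + 13805721749199518460916737 * t^15 - 1573202877300834187134466 * t^14
     + 131582338768322853956994 * t^13 - 7736513993329973661368 * t^12
     + 288737344956855301342 * t^11 - 4371158470492451828 * t^10 - 164458937576610742 * t^9
     + 11886702497030032 * t^8 - 341638600598298 * t^7 + 5570891154842 * t^6
     - 53184503243 * t^5 + 279917500 * t^4 - 661245 * t^3 + 142 * t^2 + t"

definition D7 :: "'a::comm_ring_1 \<Rightarrow> 'a" where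
  "D7 t =
    t^48 - 2769 * t^47 + 2630641 * t^46 - 1195782497 * t^45 + 305993127089 * t^44
     - 48551559344145 * t^43 + 5083730101530753 * t^42 - 366971376492201338 * t^41
     + 18871718211768417242 * t^40 - 709234610141846974874 * t^39
     + 19874722637854592209338 * t^38 - 422023241997789381263002 * t^37
     + 6880098547452856483997402 * t^36 - 87057778313447181201990522 * t^35
     + 862879164715733847737203343 * t^34 - 6750900711491569851736413311 * t^33
     + 41958615314622858303912597215 * t^32 - 208258356862493902206466194607 * t^31
     + 828959040281722890327985220255 * t^30 - 2654944041424536277948746010303 * t^29
     + 6859440538554030239641036025103 * t^28 - 14324708604336971207868317957868 * t^27
     + 24214587194571650834572683444012 * t^26 - 33166490975387358866518005011884 * t^25
     + 36830850383375837481096026357868 * t^24 - 33166490975387358866518005011884 * t^23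
     + 24214587194571650834572683444012 * t^22 - 14324708604336971207868317957868 * t^21
     + 6859440538554030239641036025103 * t^20 - 2654944041424536277948746010303 * t^19
     + 828959040281722890327985220255 * t^18 - 208258356862493902206466194607 * t^17
     + 41958615314622858303912597215 * t^16 - 6750900711491569851736413311 * t^15
     + 862879164715733847737203343 * t^14 - 87057778313447181201990522 * t^13
     + 6880098547452856483997402 * t^12 - 422023241997789381263002 * t^11
     + 19874722637854592209338 * t^10 - 709234610141846974874 * t^9
     + 18871718211768417242 * t^8 - 366971376492201338 * t^7 + 5083730101530753 * t^6
     - 48551559344145 * t^5 + 305993127089 * t^4 - 1195782497 * t^3 + 2630641 * t^2 - 2769 * t
     + 1"

end

(*
By the matrix tree theorem, s(7,n) is the determinant of the Laplacian of the grid with the row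
of the last vertex replaced by a unit vector. Ordered column by column this matrix is banded, with
entries -1 on the outermost upper diagonal, so its determinant is governed by a 7 x 7 determinant
of functions that are harmonic off the last column. Separating variables in the eigenvectors of
the path on 7 vertices gives s(7,n) as the product of U_n(4 - c) over the eigenvalue parameters
c = 2 cos (k pi / 7), k = 1, ..., 6, where U_0 = 0, U_1 = 1, U_(n+2) = y U_(n+1) - U_n. These c are
the roots a, b, d of t^3 - t^2 - 2 t + 1 and their negatives. The product over a, b, d satisfies an
integer recurrence of order 6, the product over -a, -b, -d one of order 8, and a Horner scheme
in the space of bilinear forms in the two windows checks that D7 annihilates the product sequence
and that the initial terms give N7.
*)

theory Submission
  imports Defs "Jordan_Normal_Form.Determinant"
begin

text \<open>The matrix tree theorem comes from expanding the Laplacian multilinearly in its rows: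
  one neighbour chosen per non-root row is a parent map, and its determinant is 1 or 0 according to
  whether following parents always ends at the root. The eigenvectors are not normalised and no
  product of the numbers 2 - c is computed. The part of the determinant that is independent of n is
  read off at n = 1, where the grid is a path with exactly one spanning tree. Since D7 has degree
  48, checking N7 directly would need 49 exact tree counts and a separate proof of the recurrence.
  With the six parameters split into two triples, a bilinear form in the windows is an element of
  Z[x]/(p) tensor Z[y]/(q), of rank 6 * 8 = 48, and shifting n is multiplication by x y. One Horner
  pass with D7 in this ring yields both the coefficients of N7 and the recurrence.\<close>

section \<open>Spanning trees as parent maps\<close>

text \<open>A spanning tree oriented towards \<open>r\<close>. The witness \<open>d\<close> excludes
  directed cycles: it drops along \<open>f\<close>, so every vertex reaches \<open>r\<close>. It is
  left existential because different arguments supply different depths. Extensionality makes each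
  tree correspond to a single function.\<close>

definition parent_maps :: "'a set \<Rightarrow> ('a \<Rightarrow> 'a set) \<Rightarrow> 'a \<Rightarrow> ('a \<Rightarrow> 'a) set" where
  "parent_maps V nb r =
     {f \<in> (\<Pi>\<^sub>E v\<in>V - {r}. nb v). \<exists>d::'a \<Rightarrow> nat. \<forall>v\<in>V - {r}. d (f v) < d v}"

definition parent_edges :: "'a set \<Rightarrow> 'a \<Rightarrow> ('a \<Rightarrow> 'a) \<Rightarrow> 'a set set" where
  "parent_edges V r f = (\<lambda>v. {v, f v}) ` (V - {r})"

lemma connected_parent_edges:
  fixes d :: "'a \<Rightarrow> nat"
  assumes r: "r \<in> V" and f: "\<And>v. v \<in> V - {r} \<Longrightarrow> f v \<in> V"
    and d: "\<And>v. v \<in> V - {r} \<Longrightarrow> d (f v) < d v"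
  shows "graph_connected V (parent_edges V r f)"
proof -
  let ?R = "{(x, y). {x, y} \<in> parent_edges V r f}"
  have to_root: "(v, r) \<in> ?R\<^sup>*" if "v \<in> V" for v
    using that
  proof (induction "d v" arbitrary: v rule: less_induct)
    case less
    show ?case
    proof (cases "v = r")
      case False
      then have v: "v \<in> V - {r}" using less by auto
      have "(v, f v) \<in> ?R" using v by (auto simp: parent_edges_def)
      moreover have "(f v, r) \<in> ?R\<^sup>*" using less.hyps[OF d[OF v] f[OF v]] .
      ultimately show ?thesis by (rule converse_rtrancl_into_rtrancl)
    qed auto
  qed
  have "sym ?R" by (auto simp: sym_def insert_commute)
  then have "sym (?R\<^sup>*)" by (rule sym_rtrancl)
  then have "(u, v) \<in> ?R\<^sup>*" if "u \<in> V" "v \<in> V" for u v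
    using to_root[OF that(1)] to_root[OF that(2)] by (meson rtrancl_trans symD)
  then show ?thesis using r by (auto simp: graph_connected_def)
qed

lemma graph_cycle_two_neighbours:
  assumes "graph_cycle E p" "v \<in> set p"
  obtains u w where "u \<in> set p" "w \<in> set p" "u \<noteq> w" "{v, u} \<in> E" "{v, w} \<in> E"
proof -
  define n where "n = length p"
  have n: "n \<ge> 3" and dist: "distinct p"
    and e: "\<And>i. Suc i < n \<Longrightarrow> {p ! i, p ! Suc i} \<in> E" and l: "{last p, hd p} \<in> E"
    using assms(1) by (auto simp: graph_cycle_def n_def)
  have ne: "p \<noteq> []" using n n_def by auto
  have l': "{p ! (n - 1), p ! 0} \<in> E" using l ne by (simp add: last_conv_nth hd_conv_nth n_def)
  \<comment> \<open>Reading indices modulo \<open>n\<close> treats the closing edge like all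
    others.\<close>
  have e': "{p ! (i mod n), p ! (Suc i mod n)} \<in> E" for i
  proof (cases "Suc (i mod n) = n")
    case True
    then have "Suc i mod n = 0" by (simp add: mod_Suc)
    then show ?thesis using True l' by (metis diff_Suc_1)
  next
    case False
    have "i mod n < n" using n by simp
    then have "Suc (i mod n) < n" using False by simp
    then show ?thesis using e[of "i mod n"] False by (simp add: mod_Suc)
  qed
  obtain i where i: "i < n" "v = p ! i" using assms(2) by (auto simp: in_set_conv_nth n_def)
  let ?a = "Suc i mod n" and ?b = "(i + n - 1) mod n"
  have "Suc (i + n - 1) mod n = i" using i n by simp
  then have "{p ! ?b, p ! i} \<in> E" using e'[of "i + n - 1"] by simp
  moreover have "{p ! i, p ! ?a} \<in> E" using e'[of i] i by simp
  moreover have ab: "?a < n" "?b < n" using n by auto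
  \<comment> \<open>If successor and predecessor agreed, two steps forward would return to
    \<open>i\<close>, impossible on at least three indices.\<close>
  moreover have "?a \<noteq> ?b"
  proof
    assume eq: "?a = ?b"
    have "Suc ?a mod n = Suc ?b mod n" using eq by simp
    then have "Suc (Suc i) mod n = i" using \<open>Suc (i + n - 1) mod n = i\<close> by (simp add: mod_Suc_eq)
    then show False using n i
      by (cases "Suc (Suc i) < n") (auto simp: mod_if split: if_splits)
  qed
  then have "p ! ?a \<noteq> p ! ?b" using dist ab by (simp add: nth_eq_iff_index_eq n_def)
  ultimately show thesis
    using that[of "p ! ?a" "p ! ?b"] i by (auto simp: n_def insert_commute)
qed

text \<open>Both cycle neighbours of a vertex of maximal depth would have to be its parent.\<close>

lemma acyclic_parent_edges:
  fixes d :: "'a \<Rightarrow> nat"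
  assumes d: "\<And>v. v \<in> V - {r} \<Longrightarrow> d (f v) < d v"
  shows "\<not> graph_cycle (parent_edges V r f) p"
proof
  assume p: "graph_cycle (parent_edges V r f) p"
  then have ne: "set p \<noteq> {}" by (auto simp: graph_cycle_def)
  have "Max (d ` set p) \<in> d ` set p" using ne by (intro Max_in) auto
  then obtain v where v: "v \<in> set p" "d v = Max (d ` set p)" by (metis imageE)
  have max: "d w \<le> d v" if "w \<in> set p" for w using that v by simp
  obtain u w where uw: "u \<in> set p" "w \<in> set p" "u \<noteq> w"
    "{v, u} \<in> parent_edges V r f" "{v, w} \<in> parent_edges V r f"
    using graph_cycle_two_neighbours[OF p v(1)] by metis
  have "x = f v" if x: "x \<in> set p" "{v, x} \<in> parent_edges V r f" for x
  proof -
    obtain y where y: "y \<in> V - {r}" "{v, x} = {y, f y}"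
      using x(2) by (auto simp: parent_edges_def)
    then consider "v = y" "x = f y" | "x = y" "v = f y" by (auto simp: doubleton_eq_iff)
    then show ?thesis
      using d[OF y(1)] max[OF x(1)] by cases auto
  qed
  then show False using uw by metis
qed

lemma rtrancl_distinct_path:
  assumes "(x, y) \<in> R\<^sup>*"
  obtains p where "p \<noteq> []" "hd p = x" "last p = y" "distinct p"
    "\<And>i. Suc i < length p \<Longrightarrow> (p ! i, p ! Suc i) \<in> R"
proof -
  have "\<exists>p. p \<noteq> [] \<and> hd p = x \<and> last p = y \<and> distinct p \<and>
     (\<forall>i. Suc i < length p \<longrightarrow> (p ! i, p ! Suc i) \<in> R)"
    using assms
  proof (induction rule: rtrancl_induct)
    case base
    show ?case by (rule exI[of _ "[x]"]) simp
  next
    case (step y z)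
    then obtain p where p: "p \<noteq> []" "hd p = x" "last p = y" "distinct p"
      "\<And>i. Suc i < length p \<Longrightarrow> (p ! i, p ! Suc i) \<in> R" by blast
    show ?case
    proof (cases "z \<in> set p")
      case True
      then obtain k where k: "k < length p" "p ! k = z" by (auto simp: in_set_conv_nth)
      \<comment> \<open>The walk has returned to a vertex already listed, so the loop is cut off
        there.\<close>
      let ?q = "take (Suc k) p"
      have "last ?q = z" using k by (simp add: take_Suc_conv_app_nth)
      then show ?thesis using p k
        by (intro exI[of _ ?q]) auto
    next
      case False
      have "(( p @ [z]) ! i, (p @ [z]) ! Suc i) \<in> R" if "Suc i < length (p @ [z])" for i
      proof (cases "Suc i < length p")
        case True then show ?thesis using p(5)[of i] by (simp add: nth_append)
      next
        case F: False
        then have "i = length p - 1" using that by auto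
        then have "p ! i = y" using p(1,3) by (simp add: last_conv_nth)
        then show ?thesis using F that step(2) p(1) \<open>i = length p - 1\<close>
          by (simp add: nth_append)
      qed
      then show ?thesis using p False by (intro exI[of _ "p @ [z]"]) auto
    qed
  qed
  then show thesis using that by blast
qed

text \<open>If \<open>g\<close> does not give \<open>v\<close> the parent \<open>f v\<close>, the
  edge between them must be the one \<open>g\<close> assigns to \<open>f v\<close>, so
  \<open>g (f v) = v\<close>. By induction on depth \<open>f (f v) = v\<close> too, and
  \<open>d\<close> would drop twice and return.\<close>

lemma parent_edges_inj:
  fixes d :: "'a \<Rightarrow> nat"
  assumes d: "\<And>v. v \<in> V - {r} \<Longrightarrow> d (f v) < d v"
    and f: "\<And>v. v \<in> V - {r} \<Longrightarrow> f v \<in> V"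
    and sub: "parent_edges V r f \<subseteq> parent_edges V r g"
    and v: "v \<in> V - {r}"
  shows "f v = g v"
  using v
proof (induction "d v" arbitrary: v rule: less_induct)
  case less
  show ?case
  proof (rule ccontr)
    assume ne: "f v \<noteq> g v"
    have "{v, f v} \<in> parent_edges V r g" using less sub by (auto simp: parent_edges_def)
    then obtain y where y: "y \<in> V - {r}" "{v, f v} = {y, g y}" by (auto simp: parent_edges_def)
    then have fy: "f v = y" "g y = v" using ne by (auto simp: doubleton_eq_iff)
    have "f y = g y" using less.hyps[of y] d[OF less.prems] fy y by simp
    then show False using fy d[OF y(1)] d[OF less.prems] by simp
  qed
qed

text \<open>Here \<open>d\<close> is the distance to the root, and the parent is the next vertex on
  a shortest path.\<close>

lemma tree_parent_map:
  assumes tree: "is_tree V T" and r: "r \<in> V"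
  obtains f and d :: "'a \<Rightarrow> nat" where "f \<in> extensional (V - {r})"
    "\<And>v. v \<in> V - {r} \<Longrightarrow> {v, f v} \<in> T \<and> f v \<in> V \<and> d (f v) < d v"
proof -
  let ?R = "{(x, y). {x, y} \<in> T}"
  define d where "d v = (LEAST k. (v, r) \<in> ?R ^^ k)" for v
  have conn: "(v, r) \<in> ?R\<^sup>*" if "v \<in> V" for v
    using tree that r by (auto simp: is_tree_def graph_connected_def)
  have sub: "e \<subseteq> V" if "e \<in> T" for e
    using tree that by (auto simp: is_tree_def simple_graph_def)
  have ex: "\<exists>u. {v, u} \<in> T \<and> u \<in> V \<and> d u < d v" if v: "v \<in> V - {r}" for v
  proof -
    obtain k where k: "(v, r) \<in> ?R ^^ k" using conn[of v] v rtrancl_power by blast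
    then have dv: "(v, r) \<in> ?R ^^ d v" unfolding d_def by (rule LeastI)
    obtain m where m: "d v = Suc m" using dv v by (cases "d v") auto
    then obtain u where u: "(v, u) \<in> ?R" "(u, r) \<in> ?R ^^ m"
      using dv by (metis relpow_Suc_D2)
    have "d u \<le> m" unfolding d_def using u(2) by (rule Least_le)
    then show ?thesis using u m sub[of "{v, u}"] by auto
  qed
  then obtain f where f: "\<And>v. v \<in> V - {r} \<Longrightarrow> {v, f v} \<in> T \<and> f v \<in> V \<and> d (f v) < d v"
    by metis
  show thesis
    using f by (intro that[of "restrict f (V - {r})" d] restrict_extensional) simp
qed

text \<open>The parent edges already connect all vertices, so a further edge of \<open>T\<close>
  would close a cycle with the path joining its ends.\<close>

lemma tree_eq_parent_edges:
  fixes d :: "'a \<Rightarrow> nat"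
  assumes tree: "is_tree V T" and r: "r \<in> V"
    and f: "\<And>v. v \<in> V - {r} \<Longrightarrow> {v, f v} \<in> T \<and> f v \<in> V \<and> d (f v) < d v"
  shows "parent_edges V r f = T"
proof
  show sub: "parent_edges V r f \<subseteq> T" using f by (auto simp: parent_edges_def)
  show "T \<subseteq> parent_edges V r f"
  proof
    fix e assume e: "e \<in> T"
    then have "card e = 2" "e \<subseteq> V" using tree by (auto simp: is_tree_def simple_graph_def)
    then obtain x y where xy: "e = {x, y}" "x \<noteq> y" "x \<in> V" "y \<in> V"
      by (auto simp: card_2_iff)
    show "e \<in> parent_edges V r f"
    proof (rule ccontr)
      assume ne: "e \<notin> parent_edges V r f"
      have "graph_connected V (parent_edges V r f)"
        using f by (intro connected_parent_edges[OF r, of f d]) auto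
      then have "(x, y) \<in> {(x, y). {x, y} \<in> parent_edges V r f}\<^sup>*"
        using xy by (auto simp: graph_connected_def)
      then obtain p where p: "p \<noteq> []" "hd p = x" "last p = y" "distinct p"
        and pe: "\<And>i. Suc i < length p \<Longrightarrow> (p ! i, p ! Suc i) \<in> {(x, y). {x, y} \<in> parent_edges V r f}"
        using rtrancl_distinct_path by metis
      \<comment> \<open>Length 1 would force \<open>x = y\<close>, and length 2 would make the extra
        edge itself a parent edge.\<close>
      have "length p \<ge> 3"
      proof (rule ccontr)
        assume "\<not> length p \<ge> 3"
        then consider "length p = 1" | "length p = 2" using p(1)
          by (cases p rule: list.exhaust; cases "tl p"; cases "tl (tl p)") auto
        then show False
        proof cases
          case 1
          then show ?thesis using p xy by (auto simp: length_Suc_conv)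
        next
          case 2
          then have "p = [x, y]" using p by (auto simp: length_Suc_conv numeral_2_eq_2)
          then show ?thesis using pe[of 0] ne xy by simp
        qed
      qed
      then have "graph_cycle T p"
        using p pe sub e xy by (auto simp: graph_cycle_def insert_commute)
      then show False using tree by (auto simp: is_tree_def)
    qed
  qed
qed

lemma bij_betw_parent_edges:
  assumes G: "simple_graph V E" and r: "r \<in> V"
  shows "bij_betw (parent_edges V r) (parent_maps V (\<lambda>v. {u. {v, u} \<in> E}) r) (spanning_trees V E)"
proof (rule bij_betw_imageI)
  let ?P = "parent_maps V (\<lambda>v. {u. {v, u} \<in> E}) r"
  have EV: "e \<subseteq> V" "card e = 2" if "e \<in> E" for e
    using G that by (auto simp: simple_graph_def)
  have P: "{v, f v} \<in> E \<and> f v \<in> V" if "f \<in> ?P" "v \<in> V - {r}" for f v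
    using that EV(1)[of "{v, f v}"] by (auto simp: parent_maps_def PiE_def Pi_def)
  show "inj_on (parent_edges V r) ?P"
  proof (rule inj_onI)
    fix f g assume fg: "f \<in> ?P" "g \<in> ?P" "parent_edges V r f = parent_edges V r g"
    obtain d :: "'a \<Rightarrow> nat" where d: "\<And>v. v \<in> V - {r} \<Longrightarrow> d (f v) < d v"
      using fg(1) by (auto simp: parent_maps_def)
    have "f v = g v" if "v \<in> V - {r}" for v
      using parent_edges_inj[of V r d f g v] d P[OF fg(1)] fg(3) that by auto
    then show "f = g" using fg(1,2)
      by (intro extensionalityI[of _ "V - {r}"]) (auto simp: parent_maps_def PiE_def)
  qed
  show "parent_edges V r ` ?P = spanning_trees V E"
  proof (intro equalityI subsetI)
    fix T assume "T \<in> parent_edges V r ` ?P"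
    then obtain f where f: "f \<in> ?P" "T = parent_edges V r f" by auto
    obtain d :: "'a \<Rightarrow> nat" where d: "\<And>v. v \<in> V - {r} \<Longrightarrow> d (f v) < d v"
      using f(1) by (auto simp: parent_maps_def)
    have "T \<subseteq> E" using P[OF f(1)] f(2) by (auto simp: parent_edges_def)
    moreover have "simple_graph V T"
      using G \<open>T \<subseteq> E\<close> by (auto simp: simple_graph_def)
    ultimately show "T \<in> spanning_trees V E"
      using connected_parent_edges[OF r, of f d] acyclic_parent_edges[of V r d f] d P[OF f(1)] f(2)
      by (auto simp: spanning_trees_def is_tree_def)
  next
    fix T assume "T \<in> spanning_trees V E"
    then have T: "T \<subseteq> E" "is_tree V T" by (auto simp: spanning_trees_def)
    obtain f and d :: "'a \<Rightarrow> nat" where fd: "f \<in> extensional (V - {r})"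
      "\<And>v. v \<in> V - {r} \<Longrightarrow> {v, f v} \<in> T \<and> f v \<in> V \<and> d (f v) < d v"
      using tree_parent_map[OF T(2) r] by metis
    have "f \<in> ?P" using fd T(1) by (auto simp: parent_maps_def PiE_def)
    then show "T \<in> parent_edges V r ` ?P"
      using tree_eq_parent_edges[OF T(2) r fd(2)] by force
  qed
qed

lemma card_spanning_trees:
  assumes "simple_graph V E" "r \<in> V"
  shows "card (spanning_trees V E) = card (parent_maps V (\<lambda>v. {u. {v, u} \<in> E}) r)"
  using bij_betw_same_card[OF bij_betw_parent_edges[OF assms]] by simp

section \<open>The matrix tree theorem\<close>

definition parent_mat :: "nat \<Rightarrow> nat \<Rightarrow> (nat \<Rightarrow> nat) \<Rightarrow> 'a::idom mat" where
  "parent_mat N r f = mat N N (\<lambda>(v, w).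
     of_bool (w = v) - (if v = r then 0 else of_bool (w = f v)))"

text \<open>Each non-root row is written as a sum of differences of unit vectors, one per neighbour,
  with the degree arising from the sum. Picking one summand in every row gives a
  \<open>parent_mat\<close>.\<close>

definition rooted_laplacian :: "nat \<Rightarrow> (nat \<Rightarrow> nat set) \<Rightarrow> nat \<Rightarrow> 'a::idom mat" where
  "rooted_laplacian N nb r = mat N N (\<lambda>(v, w).
     if v = r then of_bool (w = v) else \<Sum>u\<in>nb v. of_bool (w = v) - of_bool (w = u))"

text \<open>If \<^term>\<open>f\<close> strictly decreases a depth function, only the identity permutation contributes to
  the Leibniz formula: a moved vertex must be sent to its parent, which is then moved too,
  and so on up to the root, which is fixed.\<close>

lemma det_parent_mat_tree:
  fixes d :: "nat \<Rightarrow> nat"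
  assumes r: "r < N" and f: "\<And>v. v \<in> {0..<N} - {r} \<Longrightarrow> f v < N"
    and d: "\<And>v. v \<in> {0..<N} - {r} \<Longrightarrow> d (f v) < d v"
  shows "det (parent_mat N r f :: 'a::idom mat) = 1"
proof -
  let ?A = "parent_mat N r f :: 'a mat"
  have A: "?A \<in> carrier_mat N N" by (simp add: parent_mat_def)
  have nz: "p = id" if p: "p permutes {0..<N}" and nz: "(\<Prod>i = 0..<N. ?A $$ (i, p i)) \<noteq> 0" for p
  proof -
    have step: "p v = v \<or> v \<noteq> r \<and> p v = f v" if v: "v < N" for v
    proof -
      have "?A $$ (v, p v) \<noteq> 0" using nz v by auto
      moreover have "p v < N" using p v by (metis atLeastLessThan_iff permutes_in_image zero_le)
      ultimately show ?thesis using v by (auto simp: parent_mat_def split: if_splits)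
    qed
    have "p v = v" if "v < N" for v
      using that
    proof (induction "d v" arbitrary: v rule: less_induct)
      case less
      show ?case
      proof (rule ccontr)
        assume ne: "p v \<noteq> v"
        then have v: "v \<in> {0..<N} - {r}" "p v = f v" using step[of v] less by auto
        have "p (f v) = f v" using less.hyps[OF d[OF v(1)] f[OF v(1)]] .
        then have "p (f v) = p v" using v by simp
        then have "f v = v" using permutes_inj[OF p] by (simp add: inj_eq)
        then show False using ne v by simp
      qed
    qed
    moreover have "p v = v" if "\<not> v < N" for v using p that by (simp add: permutes_def)
    ultimately show "p = id" by (metis eq_id_iff)
  qed
  have fin: "finite {p. p permutes {0..<N}}" by (simp add: finite_permutations)
  have "det ?A = (\<Sum>p\<in>{p. p permutes {0..<N}}. signof p * (\<Prod>i = 0..<N. ?A $$ (i, p i)))"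
    by (rule det_def'[OF A])
  also have "\<dots> = (\<Sum>p\<in>{id}. signof p * (\<Prod>i = 0..<N. ?A $$ (i, p i)))"
    using nz by (intro sum.mono_neutral_right fin) (auto simp: permutes_id)
  also have "\<dots> = (\<Prod>i = 0..<N. ?A $$ (i, i))" by simp
  also have "\<dots> = 1"
  proof (intro prod.neutral ballI)
    fix i assume i: "i \<in> {0..<N}"
    then have "i \<noteq> f i" if "i \<noteq> r" using d[of i] that by fastforce
    then show "?A $$ (i, i) = 1" using i by (auto simp: parent_mat_def)
  qed
  finally show ?thesis .
qed

text \<open>Otherwise the indicator vector of the vertices that never reach the root is in the kernel.\<close>

lemma det_parent_mat_not_tree:
  assumes r: "r < N" and f: "\<And>v. v \<in> {0..<N} - {r} \<Longrightarrow> f v < N"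
    and d: "\<nexists>d::nat \<Rightarrow> nat. \<forall>v\<in>{0..<N} - {r}. d (f v) < d v"
  shows "det (parent_mat N r f :: 'a::idom mat) = 0"
proof -
  let ?A = "parent_mat N r f :: 'a mat"
  define g where "g = f(r := r)"
  define reach where "reach v \<longleftrightarrow> (\<exists>k. (g ^^ k) v = r)" for v
  define x :: "'a vec" where "x = vec N (\<lambda>v. of_bool (\<not> reach v))"
  have reach_step: "reach (f v) \<longleftrightarrow> reach v" if v: "v \<noteq> r" for v
  proof
    assume "reach (f v)"
    then obtain k where "(g ^^ k) (f v) = r" by (auto simp: reach_def)
    then have "(g ^^ Suc k) v = r" using v by (simp add: funpow_Suc_right g_def del: funpow.simps)
    then show "reach v" unfolding reach_def by blast
  next
    assume "reach v"
    then obtain k where k: "(g ^^ k) v = r" by (auto simp: reach_def)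
    with v obtain m where "k = Suc m" by (cases k) auto
    then have "(g ^^ m) (f v) = r" using k v by (simp add: funpow_Suc_right g_def del: funpow.simps)
    then show "reach (f v)" unfolding reach_def by blast
  qed
  have "\<exists>v<N. \<not> reach v"
  proof (rule ccontr)
    assume "\<not> ?thesis"
    then have all: "reach v" if "v < N" for v using that by auto
    define d where "d v = (LEAST k. (g ^^ k) v = r)" for v
    have "d (f v) < d v" if v: "v \<in> {0..<N} - {r}" for v
    proof -
      have "\<exists>k. (g ^^ k) v = r" using all v by (simp add: reach_def)
      then have dv: "(g ^^ d v) v = r" unfolding d_def by (rule LeastI_ex)
      then obtain m where m: "d v = Suc m" using v by (cases "d v") auto
      then have "(g ^^ m) (f v) = r" using dv v
        by (simp add: funpow_Suc_right g_def del: funpow.simps)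
      then have "d (f v) \<le> m" unfolding d_def by (rule Least_le)
      then show ?thesis using m by simp
    qed
    then show False using d by blast
  qed
  then obtain v where v: "v < N" "\<not> reach v" by blast
  have "x $ v \<noteq> 0\<^sub>v N $ v" using v by (simp add: x_def)
  then have "x \<noteq> 0\<^sub>v N" by metis
  moreover have "?A *\<^sub>v x = 0\<^sub>v N"
  proof (rule eq_vecI)
    fix v assume "v < dim_vec (0\<^sub>v N :: 'a vec)"
    then have v: "v < N" by simp
    have "(?A *\<^sub>v x) $ v = (\<Sum>w = 0..<N. (of_bool (w = v) - (if v = r then 0 else of_bool (w = f v)))
        * (of_bool (\<not> reach w) :: 'a))"
      using v by (simp add: parent_mat_def x_def scalar_prod_def)
    also have "\<dots> = of_bool (\<not> reach v) - (if v = r then 0 else of_bool (\<not> reach (f v)))"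
    proof (cases "v = r")
      case True
      then show ?thesis using v by (simp add: of_bool_def if_distrib[of "\<lambda>y. y * _"] sum.delta cong: if_cong)
    next
      case False
      then show ?thesis using v f[of v]
        by (simp add: left_diff_distrib sum_subtractf of_bool_def if_distrib[of "\<lambda>y. y * _"] sum.delta cong: if_cong)
    qed
    also have "\<dots> = 0"
    proof (cases "v = r")
      case True
      have "reach r" unfolding reach_def by (rule exI[of _ 0]) simp
      then show ?thesis using True by simp
    qed (simp add: reach_step)
    finally show "(?A *\<^sub>v x) $ v = 0\<^sub>v N $ v" using v by simp
  qed (simp add: parent_mat_def)
  moreover have "x \<in> carrier_vec N" by (simp add: x_def)
  moreover have "?A \<in> carrier_mat N N" by (simp add: parent_mat_def)
  ultimately show ?thesis using det_0_iff_vec_prod_zero by blast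
qed

text \<open>In each Leibniz term the product of row sums expands into a sum over choice functions.
  Exchanging the two sums leaves a sum of determinants of \<open>parent_mat\<close>, each 0 or
  1.\<close>

theorem det_rooted_laplacian:
  assumes r: "r < N" and nb: "\<And>v. v < N \<Longrightarrow> nb v \<subseteq> {0..<N}"
  shows "det (rooted_laplacian N nb r :: 'a::idom mat) = of_nat (card (parent_maps {0..<N} nb r))"
proof -
  let ?L = "rooted_laplacian N nb r :: 'a mat" and ?V = "{0..<N} - {r}"
  let ?F = "\<Pi>\<^sub>E v\<in>?V. nb v"
  have fin: "finite (nb v)" if "v < N" for v using nb[OF that] finite_subset by blast
  then have finF: "finite ?F" by (intro finite_PiE) auto
  have L: "?L \<in> carrier_mat N N" by (simp add: rooted_laplacian_def)
  have A: "(parent_mat N r f :: 'a mat) \<in> carrier_mat N N" for f by (simp add: parent_mat_def)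
  have bound: "p i < N" if "p permutes {0..<N}" "i < N" for p i
    using that by (metis atLeastLessThan_iff permutes_in_image zero_le)
  have split: "(\<Prod>i = 0..<N. h i) = h r * (\<Prod>i\<in>?V. h i)" for h :: "nat \<Rightarrow> 'a"
    using r by (intro prod.remove) auto
  have expand: "(\<Prod>i = 0..<N. ?L $$ (i, p i)) =
      (\<Sum>f\<in>?F. \<Prod>i = 0..<N. parent_mat N r f $$ (i, p i))"
    if p: "p permutes {0..<N}" for p
  proof -
    have "(\<Prod>i\<in>?V. ?L $$ (i, p i)) = (\<Prod>i\<in>?V. \<Sum>u\<in>nb i. of_bool (p i = i) - of_bool (p i = u))"
      using bound[OF p] by (intro prod.cong) (auto simp: rooted_laplacian_def)
    also have "\<dots> = (\<Sum>f\<in>?F. \<Prod>i\<in>?V. of_bool (p i = i) - of_bool (p i = f i))"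
      using fin by (intro prod_sum_PiE) auto
    also have "\<dots> = (\<Sum>f\<in>?F. \<Prod>i\<in>?V. parent_mat N r f $$ (i, p i))"
      using bound[OF p] by (intro sum.cong prod.cong) (auto simp: parent_mat_def)
    finally have 1: "(\<Prod>i\<in>?V. ?L $$ (i, p i)) = (\<Sum>f\<in>?F. \<Prod>i\<in>?V. parent_mat N r f $$ (i, p i))" .
    have 2: "parent_mat N r f $$ (r, p r) = ?L $$ (r, p r)" for f
      using r bound[OF p r] by (simp add: parent_mat_def rooted_laplacian_def)
    show ?thesis unfolding split 1 2 by (simp add: sum_distrib_left)
  qed
  have "det ?L = (\<Sum>p\<in>{p. p permutes {0..<N}}. signof p * (\<Prod>i = 0..<N. ?L $$ (i, p i)))"
    by (rule det_def'[OF L])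
  also have "\<dots> = (\<Sum>p\<in>{p. p permutes {0..<N}}. \<Sum>f\<in>?F.
      signof p * (\<Prod>i = 0..<N. parent_mat N r f $$ (i, p i)))"
    using expand by (intro sum.cong) (simp_all add: sum_distrib_left)
  also have "\<dots> = (\<Sum>f\<in>?F. det (parent_mat N r f))"
    by (subst sum.swap) (simp add: det_def'[OF A])
  also have "\<dots> = (\<Sum>f\<in>?F. of_bool (\<exists>d::nat \<Rightarrow> nat. \<forall>v\<in>?V. d (f v) < d v))"
  proof (rule sum.cong)
    fix f assume f: "f \<in> ?F"
    then have fN: "f v < N" if "v \<in> ?V" for v
      using that nb[of v] by (auto simp: PiE_def Pi_def)
    show "det (parent_mat N r f) = (of_bool (\<exists>d::nat \<Rightarrow> nat. \<forall>v\<in>?V. d (f v) < d v) :: 'a)"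
    proof (cases "\<exists>d::nat \<Rightarrow> nat. \<forall>v\<in>?V. d (f v) < d v")
      case True
      then obtain d :: "nat \<Rightarrow> nat" where "\<forall>v\<in>?V. d (f v) < d v" by blast
      then have "det (parent_mat N r f :: 'a mat) = 1"
        using fN by (intro det_parent_mat_tree[OF r, of f d]) auto
      then show ?thesis using True by simp
    next
      case False
      then show ?thesis using det_parent_mat_not_tree[OF r fN False, where 'a = 'a] by simp
    qed
  qed simp
  also have "\<dots> = of_nat (card (parent_maps {0..<N} nb r))"
  proof -
    have "parent_maps {0..<N} nb r = ?F \<inter> {f. \<exists>d::nat \<Rightarrow> nat. \<forall>v\<in>?V. d (f v) < d v}"
      by (auto simp: parent_maps_def)
    then show ?thesis using finF by (simp add: sum_of_bool_eq)
  qed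
  finally show ?thesis .
qed

section \<open>Invariance of the number of parent maps under relabelling\<close>

lemma card_parent_maps_le:
  assumes h: "bij_betw h V W" and r: "r \<in> V" and nb: "\<And>v. v \<in> V \<Longrightarrow> nb v \<subseteq> V"
    and nb': "\<And>v. v \<in> V \<Longrightarrow> nb' (h v) = h ` nb v"
    and fin: "finite (parent_maps W nb' (h r))"
  shows "card (parent_maps V nb r) \<le> card (parent_maps W nb' (h r))"
proof -
  define k where "k = inv_into V h"
  have inj: "inj_on h V" and W: "h ` V = W" using h by (auto simp: bij_betw_def)
  have kh: "k (h v) = v" if "v \<in> V" for v using that inj by (simp add: k_def)
  have kV: "k w \<in> V" "h (k w) = w" if "w \<in> W" for w
    using that W by (auto simp: k_def inv_into_into f_inv_into_f)
  \<comment> \<open>Conjugation by \<open>h\<close>; the restriction keeps the image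
    extensional.\<close>
  define \<phi> where "\<phi> f = restrict (\<lambda>w. h (f (k w))) (W - {h r})" for f
  have k_ne: "k w \<in> V - {r}" if "w \<in> W - {h r}" for w
    using that kV[of w] by auto
  have h_ne: "h v \<in> W - {h r}" if "v \<in> V - {r}" for v
    using that W inj r by (auto simp: inj_on_eq_iff)
  have fV: "f v \<in> V" if "f \<in> parent_maps V nb r" "v \<in> V - {r}" for f v
    using that nb[of v] by (auto simp: parent_maps_def PiE_def Pi_def)
  show ?thesis
  proof (rule card_inj_on_le[OF _ _ fin])
    show "inj_on \<phi> (parent_maps V nb r)"
    proof (rule inj_onI)
      fix f g assume fg: "f \<in> parent_maps V nb r" "g \<in> parent_maps V nb r" "\<phi> f = \<phi> g"
      have "f v = g v" if v: "v \<in> V - {r}" for v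
      proof -
        have "\<phi> f (h v) = \<phi> g (h v)" using fg by simp
        then have "h (f v) = h (g v)" using h_ne[OF v] kh v by (simp add: \<phi>_def)
        then show ?thesis using inj fV[OF fg(1) v] fV[OF fg(2) v] by (simp add: inj_on_eq_iff)
      qed
      then show "f = g" using fg(1,2)
        by (intro extensionalityI[of _ "V - {r}"]) (auto simp: parent_maps_def PiE_def)
    qed
    show "\<phi> ` parent_maps V nb r \<subseteq> parent_maps W nb' (h r)"
    proof
      fix g assume "g \<in> \<phi> ` parent_maps V nb r"
      then obtain f where f: "f \<in> parent_maps V nb r" "g = \<phi> f" by auto
      obtain d :: "'a \<Rightarrow> nat" where d: "\<And>v. v \<in> V - {r} \<Longrightarrow> d (f v) < d v"
        using f by (auto simp: parent_maps_def)
      have gw: "g w = h (f (k w))" if "w \<in> W - {h r}" for w using that f by (simp add: \<phi>_def)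
      have "g w \<in> nb' w" if w: "w \<in> W - {h r}" for w
      proof -
        have "f (k w) \<in> nb (k w)" using f(1) k_ne[OF w] by (auto simp: parent_maps_def PiE_def Pi_def)
        then have "g w \<in> nb' (h (k w))" using nb'[of "k w"] kV(1)[of w] w gw[OF w] by auto
        then show ?thesis using kV(2)[of w] w by simp
      qed
      moreover have "g \<in> extensional (W - {h r})" using f by (simp add: \<phi>_def)
      moreover have "(d \<circ> k) (g w) < (d \<circ> k) w" if w: "w \<in> W - {h r}" for w
        using d[OF k_ne[OF w]] gw[OF w] kh fV[OF f(1) k_ne[OF w]] by simp
      ultimately show "g \<in> parent_maps W nb' (h r)"
        unfolding parent_maps_def PiE_def Pi_def by blast
    qed
  qed
qed

lemma finite_parent_maps:
  assumes "finite V" "\<And>v. v \<in> V \<Longrightarrow> finite (nb v)"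
  shows "finite (parent_maps V nb r)"
proof -
  have "finite (\<Pi>\<^sub>E v\<in>V - {r}. nb v)" using assms by (intro finite_PiE) auto
  then show ?thesis by (rule rev_finite_subset) (auto simp: parent_maps_def)
qed

lemma card_parent_maps_transport:
  assumes h: "bij_betw h V W" and V: "finite V" and r: "r \<in> V"
    and nb: "\<And>v. v \<in> V \<Longrightarrow> nb v \<subseteq> V" and nb': "\<And>v. v \<in> V \<Longrightarrow> nb' (h v) = h ` nb v"
  shows "card (parent_maps V nb r) = card (parent_maps W nb' (h r))"
proof (rule antisym)
  have W: "W = h ` V" "finite W" using h V by (auto simp: bij_betw_def)
  have inj: "inj_on h V" using h by (simp add: bij_betw_def)
  have sub: "nb' w \<subseteq> W" if "w \<in> W" for w using that nb nb' W(1) by fastforce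
  have "finite (parent_maps W nb' (h r))"
    using sub W(2) by (intro finite_parent_maps) (auto intro: finite_subset)
  with card_parent_maps_le[of h V W r nb nb'] h r nb nb'
  show "card (parent_maps V nb r) \<le> card (parent_maps W nb' (h r))" by blast
  let ?k = "inv_into V h"
  have kr: "?k (h r) = r" using inj r by simp
  have k: "bij_betw ?k W V" using h by (rule bij_betw_inv_into)
  have img: "nb (?k w) = ?k ` nb' w" if w: "w \<in> W" for w
  proof -
    have kw: "?k w \<in> V" "h (?k w) = w" using w W by (auto simp: inv_into_into f_inv_into_f)
    have "?k ` h ` nb (?k w) = nb (?k w)"
      using inj nb[OF kw(1)] by (rule inv_into_image_cancel)
    then show ?thesis using nb'[OF kw(1)] kw(2) by simp
  qed
  have "finite (parent_maps V nb r)"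
    using nb V by (intro finite_parent_maps) (auto intro: finite_subset)
  then show "card (parent_maps W nb' (h r)) \<le> card (parent_maps V nb r)"
    using card_parent_maps_le[OF k, of "h r" nb' nb] sub img kr W(1) r by auto
qed

section \<open>Determinants of banded matrices\<close>

text \<open>Multiplying by the completion of \<^term>\<open>W\<close> with unit vectors moves the determinant into the last
  \<^term>\<open>k\<close> rows; since \<^term>\<open>k\<close> is odd, the sign of the block swap cancels the one coming
  from the diagonal of minus ones.\<close>

lemma det_banded:
  fixes M W :: "nat \<Rightarrow> nat \<Rightarrow> 'a::idom"
  assumes k: "k \<le> N" "odd k"
    and diag: "\<And>v. v + k < N \<Longrightarrow> M v (v + k) = -1"
    and band: "\<And>v w. v + k < w \<Longrightarrow> w < N \<Longrightarrow> M v w = 0"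
    and ker: "\<And>v c. v + k < N \<Longrightarrow> c < k \<Longrightarrow> (\<Sum>w<N. M v w * W w c) = 0"
  shows "det (mat N N (\<lambda>(v, w). M v w)) * det (mat k k (\<lambda>(v, c). W v c)) =
    det (mat k k (\<lambda>(i, c). \<Sum>w<N. M (N - k + i) w * W w c))"
proof -
  define m where "m = N - k"
  have N: "N = m + k" using k by (simp add: m_def)
  let ?M = "mat N N (\<lambda>(v, w). M v w)" and ?W = "mat k k (\<lambda>(v, c). W v c)"
  let ?B = "mat k k (\<lambda>(i, c). \<Sum>w<N. M (N - k + i) w * W w c)"
  define X where "X = mat N N (\<lambda>(w, c). if c < k then W w c else of_bool (w = c))"
  define L where "L = mat m m (\<lambda>(v, w). M v (w + k))"
  have X: "X = four_block_mat ?W (0\<^sub>m k m) (mat m k (\<lambda>(v, c). W (v + k) c)) (1\<^sub>m m)"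
    by (rule eq_matI) (auto simp: X_def N one_mat_def)
  have detX: "det X = det ?W"
    unfolding X by (subst det_four_block_mat_upper_right_zero) auto
  define Y where "Y = ?M * X"
  have Y: "Y \<in> carrier_mat N N"
    unfolding Y_def by (rule mult_carrier_mat[of _ N N]) (auto simp: X_def)
  have Yl: "Y $$ (v, c) = (\<Sum>w<N. M v w * W w c)" if "v < N" "c < k" for v c
    using that by (simp add: Y_def X_def N scalar_prod_def atLeast0LessThan)
  have Yr: "Y $$ (v, c) = M v c" if "v < N" "k \<le> c" "c < N" for v c
    using that by (simp add: Y_def X_def scalar_prod_def of_bool_def
        if_distrib[of "\<lambda>y. _ * y"] sum.delta cong: if_cong)
  \<comment> \<open>Moving the first \<open>k\<close> columns to the end exposes the blocks:
    \<open>ker\<close> clears the upper right one, and \<open>band\<close> makes \<open>L\<close>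
    triangular.\<close>
  have "mat N N (\<lambda>(i, j). Y $$ (i, if j < m then j + k else if j < k + m then j - m else j)) =
      four_block_mat L (0\<^sub>m m k) (mat k m (\<lambda>(v, w). M (v + m) (w + k))) ?B"
    using ker by (intro eq_matI) (auto simp: L_def Yl Yr N add.commute)
  moreover have "det Y = (-1) ^ (k * m) *
      det (mat N N (\<lambda>(i, j). Y $$ (i, if j < m then j + k else if j < k + m then j - m else j)))"
    by (rule det_swap_initial_cols[OF Y]) (simp add: N)
  moreover have "det (four_block_mat L (0\<^sub>m m k) (mat k m (\<lambda>(v, w). M (v + m) (w + k))) ?B) =
      det L * det ?B"
    by (rule det_four_block_mat_upper_right_zero) (auto simp: L_def)
  moreover have "det L = (-1) ^ m"
  proof -
    have "det L = prod_list (diag_mat L)"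
      using band by (intro det_lower_triangular[of m]) (auto simp: L_def N)
    also have "diag_mat L = replicate m (-1)"
      using diag by (intro nth_equalityI) (auto simp: L_def diag_mat_def N)
    finally show ?thesis by (simp add: prod_list_replicate)
  qed
  ultimately have "det Y = (-1) ^ (k * m + m) * det ?B" by (simp add: power_add)
  also have "even (k * m + m)" using k by simp
  then have "(-1) ^ (k * m + m) = (1::'a)" by simp
  finally have "det Y = det ?B" by simp
  moreover have "det Y = det ?M * det X"
    unfolding Y_def by (rule det_mult[of _ N]) (auto simp: X_def)
  ultimately show ?thesis by (simp add: detX)
qed

lemma rooted_laplacian_mult:
  fixes g :: "nat \<Rightarrow> 'a::idom"
  assumes nb: "nb v \<subseteq> {0..<N}" and v: "v < N"
  shows "(\<Sum>w<N. rooted_laplacian N nb r $$ (v, w) * g w) =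
    (if v = r then g v else \<Sum>u\<in>nb v. g v - g u)"
proof (cases "v = r")
  case True
  then show ?thesis using v
    by (simp add: rooted_laplacian_def of_bool_def if_distrib[of "\<lambda>y. y * _"] sum.delta cong: if_cong)
next
  case False
  have "(\<Sum>w<N. rooted_laplacian N nb r $$ (v, w) * g w) =
      (\<Sum>w<N. \<Sum>u\<in>nb v. (of_bool (w = v) - of_bool (w = u)) * g w)"
    using v False by (simp add: rooted_laplacian_def sum_distrib_right)
  also have "\<dots> = (\<Sum>u\<in>nb v. \<Sum>w<N. (of_bool (w = v) - of_bool (w = u)) * g w)"
    by (rule sum.swap)
  also have "\<dots> = (\<Sum>u\<in>nb v. g v - g u)"
  proof (rule sum.cong)
    fix u assume "u \<in> nb v"
    then have "u < N" using nb by auto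
    then show "(\<Sum>w<N. (of_bool (w = v) - of_bool (w = u)) * g w) = g v - g u" using v
      by (simp add: left_diff_distrib sum_subtractf of_bool_def if_distrib[of "\<lambda>y. y * _"]
          sum.delta cong: if_cong)
  qed simp
  finally show ?thesis using False by simp
qed

text \<open>The columns of \<open>W\<close> are functions harmonic outside the last \<open>k\<close>
  vertices. The root is the last vertex, so its unit row falls into the surviving block, as row
  \<open>k - 1\<close>.\<close>

lemma det_rooted_laplacian_banded:
  fixes W :: "nat \<Rightarrow> nat \<Rightarrow> 'a::idom"
  assumes k: "k \<le> N" "odd k"
    and nb: "\<And>v. v < N \<Longrightarrow> nb v \<subseteq> {0..<N}" "\<And>v u. u \<in> nb v \<Longrightarrow> u \<le> v + k"
      "\<And>v. v + k < N \<Longrightarrow> v + k \<in> nb v"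
    and ker: "\<And>v c. v + k < N \<Longrightarrow> c < k \<Longrightarrow> (\<Sum>u\<in>nb v. W v c - W u c) = 0"
  shows "det (rooted_laplacian N nb (N - 1)) * det (mat k k (\<lambda>(v, c). W v c)) =
    det (mat k k (\<lambda>(i, c). if i = k - 1 then W (N - 1) c
      else \<Sum>u\<in>nb (N - k + i). W (N - k + i) c - W u c))"
proof -
  let ?L = "rooted_laplacian N nb (N - 1) :: 'a mat"
  have k0: "k > 0" using k by (cases k) auto
  have off: "?L $$ (v, w) = - of_bool (w \<in> nb v)" if "v < w" "v + 1 < N" "w < N" for v w
  proof -
    have "finite (nb v)" using nb(1)[of v] that finite_subset by auto
    moreover have "?L $$ (v, w) = (\<Sum>u\<in>nb v. - of_bool (w = u))"
      using that by (simp add: rooted_laplacian_def)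
    ultimately show ?thesis by (simp add: sum_negf of_bool_def sum.delta)
  qed
  have L: "?L = mat N N (\<lambda>(v, w). ?L $$ (v, w))"
    by (rule eq_matI) (auto simp: rooted_laplacian_def)
  have "det (mat N N (\<lambda>(v, w). ?L $$ (v, w))) * det (mat k k (\<lambda>(v, c). W v c)) =
    det (mat k k (\<lambda>(i, c). \<Sum>w<N. ?L $$ (N - k + i, w) * W w c))"
  proof (rule det_banded[OF k])
    fix v assume v: "v + k < N"
    show "?L $$ (v, v + k) = -1" using off[of v "v + k"] nb(3)[OF v] v k0 by simp
  next
    fix v w assume "v + k < w" "w < N"
    moreover from this have "w \<notin> nb v" using nb(2)[of w v] by auto
    ultimately show "?L $$ (v, w) = 0" using off[of v w] k0 by simp
  next
    fix v c assume "v + k < N" "c < k"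
    then show "(\<Sum>w<N. ?L $$ (v, w) * W w c) = 0"
      using ker[of v c] nb(1)[of v] k0 by (subst rooted_laplacian_mult) auto
  qed
  also have "mat k k (\<lambda>(i, c). \<Sum>w<N. ?L $$ (N - k + i, w) * W w c) =
    mat k k (\<lambda>(i, c). if i = k - 1 then W (N - 1) c
      else \<Sum>u\<in>nb (N - k + i). W (N - k + i) c - W u c)"
  proof (rule eq_matI)
    fix i c assume "i < dim_row (mat k k (\<lambda>(i, c). if i = k - 1 then W (N - 1) c
      else \<Sum>u\<in>nb (N - k + i). W (N - k + i) c - W u c))"
      "c < dim_col (mat k k (\<lambda>(i, c). if i = k - 1 then W (N - 1) c
      else \<Sum>u\<in>nb (N - k + i). W (N - k + i) c - W u c))"
    then have ic: "i < k" "c < k" by auto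
    have iN: "N - k + i < N" using ic k by simp
    have "N - k + i = N - 1 \<longleftrightarrow> i = k - 1" using ic k by auto
    then show "mat k k (\<lambda>(i, c). \<Sum>w<N. ?L $$ (N - k + i, w) * W w c) $$ (i, c) =
      mat k k (\<lambda>(i, c). if i = k - 1 then W (N - 1) c
      else \<Sum>u\<in>nb (N - k + i). W (N - k + i) c - W u c) $$ (i, c)"
      using ic rooted_laplacian_mult[of nb "N - k + i" N "N - 1" "\<lambda>w. W w c"] nb(1)[OF iN] iN by auto
  qed auto
  finally show ?thesis using L by simp
qed

section \<open>Grid graphs\<close>

text \<open>Vertices are numbered column by column from 0: \<open>v = k * j + i\<close> is row
  \<open>i\<close> of column \<open>j\<close>. Steps of \<open>k\<close> change the column, steps of
  1 the row.\<close>

definition grid_nb :: "nat \<Rightarrow> nat \<Rightarrow> nat \<Rightarrow> nat set" where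
  "grid_nb k n v = (if k \<le> v then {v - k} else {}) \<union> (if v + k < k * n then {v + k} else {}) \<union>
     (if v mod k \<noteq> 0 then {v - 1} else {}) \<union> (if Suc (v mod k) \<noteq> k then {Suc v} else {})"

lemma grid_nb_at:
  assumes "i < k" "j < n"
  shows "grid_nb k n (k * j + i) =
    (if j > 0 then {k * j + i - k} else {}) \<union> (if Suc j < n then {k * j + i + k} else {}) \<union>
    (if i > 0 then {k * j + i - 1} else {}) \<union> (if Suc i < k then {Suc (k * j + i)} else {})"
proof -
  have 1: "k \<le> k * j + i \<longleftrightarrow> j > 0" using assms by (cases j) auto
  have 2: "k * j + i + k < k * n \<longleftrightarrow> Suc j < n"
  proof
    assume "k * j + i + k < k * n"
    then have "k * Suc j < k * n" by simp
    then show "Suc j < n" by (simp only: mult_less_cancel1)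
  next
    assume "Suc j < n"
    then have "k * Suc (Suc j) \<le> k * n" by (intro mult_le_mono2) simp
    then show "k * j + i + k < k * n" using assms by simp
  qed
  have 3: "(k * j + i) mod k = i" "i \<noteq> 0 \<longleftrightarrow> i > 0" "Suc i \<noteq> k \<longleftrightarrow> Suc i < k"
    using assms by auto
  show ?thesis unfolding grid_nb_def 1 2 3 by (rule refl)
qed

lemma simple_graph_grid: "simple_graph (grid_verts k n) (grid_edges k n)"
proof -
  have "card {(i, j), (i', j')} = 2"
    if "\<bar>int i - int i'\<bar> + \<bar>int j - int j'\<bar> = 1" for i j i' j' :: nat
  proof -
    have "(i, j) \<noteq> (i', j')" using that by auto
    then show ?thesis by simp
  qed
  then show ?thesis
    unfolding simple_graph_def grid_edges_def by (auto simp: grid_verts_def)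
qed

lemma grid_edges_iff:
  "{(i, j), (i', j')} \<in> grid_edges k n \<longleftrightarrow>
     (i, j) \<in> grid_verts k n \<and> (i', j') \<in> grid_verts k n \<and>
     (i = i' \<and> (j' = Suc j \<or> j = Suc j') \<or> j = j' \<and> (i' = Suc i \<or> i = Suc i'))"
proof -
  have "\<bar>int i - int i'\<bar> + \<bar>int j - int j'\<bar> = 1 \<longleftrightarrow>
      i = i' \<and> (j' = Suc j \<or> j = Suc j') \<or> j = j' \<and> (i' = Suc i \<or> i = Suc i')" for i j i' j' :: nat
    by linarith
  then show ?thesis
    by (auto simp: grid_edges_def doubleton_eq_iff)
qed

definition grid_index :: "nat \<Rightarrow> nat \<times> nat \<Rightarrow> nat" where
  "grid_index k = (\<lambda>(i, j). k * (j - 1) + (i - 1))"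

lemma bij_betw_grid_index:
  assumes "k > 0"
  shows "bij_betw (grid_index k) (grid_verts k n) {0..<k * n}"
proof (rule bij_betw_byWitness[where f' = "\<lambda>v. (Suc (v mod k), Suc (v div k))"])
  show "\<forall>p\<in>grid_verts k n. (Suc (grid_index k p mod k), Suc (grid_index k p div k)) = p"
  proof
    fix p assume "p \<in> grid_verts k n"
    then obtain a b where "p = (Suc a, Suc b)" "a < k"
      by (cases p; cases "fst p"; cases "snd p") (auto simp: grid_verts_def)
    then show "(Suc (grid_index k p mod k), Suc (grid_index k p div k)) = p"
      by (simp add: grid_index_def)
  qed
  show "\<forall>v\<in>{0..<k * n}. grid_index k (Suc (v mod k), Suc (v div k)) = v"
    by (auto simp: grid_index_def)
  show "grid_index k ` grid_verts k n \<subseteq> {0..<k * n}"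
  proof safe
    fix i j assume "(i, j) \<in> grid_verts k n"
    then have ij: "i - 1 < k" "j - 1 < n" by (auto simp: grid_verts_def)
    have "k * (j - 1) + (i - 1) < k * Suc (j - 1)" using ij by simp
    also have "\<dots> \<le> k * n" using ij by (intro mult_le_mono2) simp
    finally show "grid_index k (i, j) \<in> {0..<k * n}" by (simp add: grid_index_def)
  qed
  show "(\<lambda>v. (Suc (v mod k), Suc (v div k))) ` {0..<k * n} \<subseteq> grid_verts k n"
    using assms by (auto simp: grid_verts_def Suc_le_eq less_mult_imp_div_less mult.commute)
qed

lemma grid_nb_index:
  assumes "(i, j) \<in> grid_verts k n"
  shows "grid_nb k n (grid_index k (i, j)) =
    grid_index k ` {u. {(i, j), u} \<in> grid_edges k n}"
proof -
  obtain a b where ab: "i = Suc a" "j = Suc b" "a < k" "b < n"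
    using assms by (cases i; cases j) (auto simp: grid_verts_def)
  let ?v = "k * b + a"
  have "{u. {(i, j), u} \<in> grid_edges k n} =
     (if b > 0 then {(i, b)} else {}) \<union> (if Suc b < n then {(i, Suc j)} else {}) \<union>
     (if a > 0 then {(a, j)} else {}) \<union> (if Suc a < k then {(Suc i, j)} else {})"
    using ab by (auto simp: grid_edges_iff grid_verts_def split: if_splits)
  then have img: "grid_index k ` {u. {(i, j), u} \<in> grid_edges k n} =
     (if b > 0 then {?v - k} else {}) \<union> (if Suc b < n then {?v + k} else {}) \<union>
     (if a > 0 then {?v - 1} else {}) \<union> (if Suc a < k then {Suc ?v} else {})"
    using ab by (cases b) (auto simp: grid_index_def)
  show ?thesis
    unfolding img using grid_nb_at[OF ab(3,4)] ab by (simp add: grid_index_def)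
qed

lemma grid_nb_subset:
  assumes "v < k * n"
  shows "grid_nb k n v \<subseteq> {0..<k * n}"
proof -
  have "Suc v < k * n" if "Suc (v mod k) \<noteq> k"
  proof (rule ccontr)
    assume "\<not> Suc v < k * n"
    then have "Suc v = k * n" using assms by simp
    then have "Suc v mod k = 0" by simp
    then show False using that by (simp add: mod_Suc split: if_splits)
  qed
  then show ?thesis using assms by (auto simp: grid_nb_def split: if_splits)
qed

lemma s_grid_eq_det:
  assumes "k > 0" "n > 0"
  shows "of_nat (s_grid k n) = (det (rooted_laplacian (k * n) (grid_nb k n) (k * n - 1)) :: 'a::idom)"
proof -
  let ?V = "grid_verts k n" and ?E = "grid_edges k n"
  have r: "(k, n) \<in> ?V" using assms by (simp add: grid_verts_def)
  have "k * (n - 1) + (k - 1) = k * n - 1"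
    using assms by (cases n) auto
  \<comment> \<open>The corner \<open>(k, n)\<close> is chosen as root because it receives the last
    index, as the banded argument requires.\<close>
  then have hr: "grid_index k (k, n) = k * n - 1" by (simp add: grid_index_def)
  have "s_grid k n = card (parent_maps ?V (\<lambda>v. {u. {v, u} \<in> ?E}) (k, n))"
    using card_spanning_trees[OF simple_graph_grid r] assms by (simp add: s_grid_def)
  also have "\<dots> = card (parent_maps {0..<k * n} (grid_nb k n) (grid_index k (k, n)))"
  proof (rule card_parent_maps_transport[OF bij_betw_grid_index[OF assms(1)] _ r])
    show "finite ?V" by (simp add: grid_verts_def)
    show "{u. {v, u} \<in> ?E} \<subseteq> ?V" for v
      using simple_graph_grid[of k n] by (auto simp: simple_graph_def)
    show "grid_nb k n (grid_index k v) = grid_index k ` {u. {v, u} \<in> ?E}" if "v \<in> ?V" for v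
      using grid_nb_index[of "fst v" "snd v"] that by simp
  qed
  finally show ?thesis
    unfolding hr using assms by (subst det_rooted_laplacian) (auto dest: grid_nb_subset)
qed

section \<open>Separation of variables\<close>

text \<open>For positive \<open>n\<close> this is the Chebyshev polynomial of the second kind of
  degree \<open>n - 1\<close>, evaluated at \<open>y/2\<close>.\<close>

fun cheb :: "'a::comm_ring_1 \<Rightarrow> nat \<Rightarrow> 'a" where
  "cheb y 0 = 0"
| "cheb y (Suc 0) = 1"
| "cheb y (Suc (Suc n)) = y * cheb y (Suc n) - cheb y n"

text \<open>Candidate eigenvector of the path Laplacian for eigenvalue \<open>2 - c\<close>. The
  value \<open>c - 1\<close> encodes the missing neighbour at the first vertex; the far end imposes
  \<open>eig c k = eig c (k - 1)\<close>.\<close>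

fun eig :: "'a::comm_ring_1 \<Rightarrow> nat \<Rightarrow> 'a" where
  "eig c 0 = 1"
| "eig c (Suc 0) = c - 1"
| "eig c (Suc (Suc n)) = c * eig c (Suc n) - eig c n"

lemma cheb_2: "cheb 2 n = of_nat n"
  by (induction "2 :: 'a::comm_ring_1" n rule: cheb.induct) (simp_all add: algebra_simps)

lemma eig_2: "eig 2 n = 1"
  by (induction "2 :: 'a::comm_ring_1" n rule: eig.induct) simp_all

text \<open>The same solution in the column direction, with parameter \<open>4 - c\<close>: its
  eigenvalue \<open>c - 2\<close> cancels the \<open>2 - c\<close> of the row direction, which makes
  the product harmonic.\<close>

definition grid_factor :: "'a::comm_ring_1 \<Rightarrow> nat \<Rightarrow> 'a" where
  "grid_factor c j = cheb (4 - c) (Suc j) - cheb (4 - c) j"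

definition grid_vec :: "nat \<Rightarrow> 'a::comm_ring_1 \<Rightarrow> nat \<Rightarrow> 'a" where
  "grid_vec k c v = eig c (v mod k) * grid_factor c (v div k)"

lemma sum_grid_nb:
  fixes g :: "nat \<Rightarrow> 'a::comm_monoid_add"
  assumes "k > 1" "i < k" "j < n"
  shows "(\<Sum>u\<in>grid_nb k n (k * j + i). g u) =
    (if j > 0 then g (k * (j - 1) + i) else 0) + (if Suc j < n then g (k * Suc j + i) else 0) +
    ((if i > 0 then g (k * j + (i - 1)) else 0) + (if Suc i < k then g (k * j + Suc i) else 0))"
proof -
  let ?v = "k * j + i"
  have nb: "grid_nb k n ?v = (if j > 0 then {?v - k} else {}) \<union> (if Suc j < n then {?v + k} else {}) \<union>
     ((if i > 0 then {?v - 1} else {}) \<union> (if Suc i < k then {Suc ?v} else {}))"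
    unfolding grid_nb_at[OF assms(2,3)] by (simp only: Un_assoc)
  have c1: "k \<le> ?v \<longleftrightarrow> j > 0" using assms by (cases j) auto
  have e1: "?v - k = k * (j - 1) + i" if "j > 0" using that by (cases j) auto
  have e3: "?v - 1 = k * j + (i - 1)" if "i > 0" using that by simp
  show ?thesis
    unfolding nb using assms c1 e1 e3
    by (subst sum.union_disjoint, simp, simp, force split: if_splits)+ (auto simp: algebra_simps)
qed

lemma eig_step:
  fixes c :: "'a::comm_ring_1"
  assumes k: "k > 1" and c: "eig c k = eig c (k - 1)" and i: "i < k"
  shows "(if i > 0 then eig c i - eig c (i - 1) else 0) +
    (if Suc i < k then eig c i - eig c (Suc i) else 0) = (2 - c) * eig c i"
proof (cases i)
  case 0
  then show ?thesis using k by (simp add: algebra_simps)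
next
  case (Suc m)
  show ?thesis
  proof (cases "Suc i < k")
    case True
    then show ?thesis using Suc by (simp add: algebra_simps)
  next
    case False
    then have "k = Suc (Suc m)" using Suc i by simp
    then have "c * eig c (Suc m) - eig c m = eig c (Suc m)" using c by simp
    then show ?thesis using Suc False by (simp add: algebra_simps)
  qed
qed

text \<open>The first identity covers columns with a right neighbour. The second covers the last
  column, where the missing neighbour leaves the defect that brings the Chebyshev value into the
  product formula.\<close>

lemma grid_factor_step:
  fixes c :: "'a::comm_ring_1"
  shows "(if j > 0 then grid_factor c j - grid_factor c (j - 1) else 0) +
    (grid_factor c j - grid_factor c (Suc j)) = (c - 2) * grid_factor c j"
    "(if j > 0 then grid_factor c j - grid_factor c (j - 1) else 0) +
    (2 - c) * grid_factor c j = (2 - c) * cheb (4 - c) (Suc j)"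
  by (cases j; simp add: grid_factor_def algebra_simps)+

lemma grid_vec_harmonic:
  fixes c :: "'a::comm_ring_1"
  assumes k: "k > 1" and c: "eig c k = eig c (k - 1)" and ij: "i < k" "j < n"
  shows "(\<Sum>u\<in>grid_nb k n (k * j + i). grid_vec k c (k * j + i) - grid_vec k c u) =
    (if Suc j < n then 0 else eig c i * ((2 - c) * cheb (4 - c) n))"
proof -
  let ?e = "eig c" and ?p = "grid_factor c"
  define G where "G i' j' = grid_vec k c (k * j' + i')" for i' j'
  have G: "G i' j' = ?e i' * ?p j'" if "i' < k" for i' j'
    using that by (simp add: G_def grid_vec_def)
  have "(\<Sum>u\<in>grid_nb k n (k * j + i). grid_vec k c (k * j + i) - grid_vec k c u) =
     (if j > 0 then G i j - G i (j - 1) else 0) + (if Suc j < n then G i j - G i (Suc j) else 0) +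
     ((if i > 0 then G i j - G (i - 1) j else 0) + (if Suc i < k then G i j - G (Suc i) j else 0))"
    unfolding G_def by (rule sum_grid_nb[OF k ij])
  also have "\<dots> =
     ?e i * ((if j > 0 then ?p j - ?p (j - 1) else 0) + (if Suc j < n then ?p j - ?p (Suc j) else 0)) +
     ((if i > 0 then ?e i - ?e (i - 1) else 0) + (if Suc i < k then ?e i - ?e (Suc i) else 0)) * ?p j"
    using ij k by (cases "j = 0") (auto simp: G algebra_simps)
  also have "\<dots> = ?e i * ((if j > 0 then ?p j - ?p (j - 1) else 0) +
      (if Suc j < n then ?p j - ?p (Suc j) else 0) + (2 - c) * ?p j)"
    unfolding eig_step[OF k c ij(1)] by (simp only: algebra_simps)
  also have "(if j > 0 then ?p j - ?p (j - 1) else 0) +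
      (if Suc j < n then ?p j - ?p (Suc j) else 0) + (2 - c) * ?p j =
      (if Suc j < n then 0 else (2 - c) * cheb (4 - c) n)"
  proof (cases "Suc j < n")
    case True
    then show ?thesis using grid_factor_step(1)[of j c] by (simp add: algebra_simps)
  next
    case False
    then have "n = Suc j" using ij by simp
    then show ?thesis using grid_factor_step(2)[of j c] by simp
  qed
  finally show ?thesis by simp
qed

section \<open>Determinants of the eigenvector matrices\<close>

lemma det_scale_columns:
  "det (mat n n (\<lambda>(i, j). A i j * s j)) = det (mat n n (\<lambda>(i, j). A i j)) * (\<Prod>j<n. s j)"
  for s :: "nat \<Rightarrow> 'a::comm_ring_1"
proof -
  have "(\<Prod>j<n. mat n n (\<lambda>(i, j). A i j * s j) $$ (p j, j)) =
      (\<Prod>j<n. mat n n (\<lambda>(i, j). A i j) $$ (p j, j)) * (\<Prod>j<n. s j)" if "p permutes {0..<n}" for p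
  proof -
    have "p j < n" if "j < n" for j
      using that \<open>p permutes {0..<n}\<close> by (metis atLeastLessThan_iff permutes_in_image zero_le)
    then show ?thesis by (simp add: prod.distrib)
  qed
  then have "(\<Sum>p | p permutes {0..<n}. signof p * (\<Prod>j<n. mat n n (\<lambda>(i, j). A i j * s j) $$ (p j, j))) =
      (\<Sum>p | p permutes {0..<n}. signof p * (\<Prod>j<n. mat n n (\<lambda>(i, j). A i j) $$ (p j, j)) * (\<Prod>j<n. s j))"
    by (intro sum.cong) (simp_all add: mult.assoc)
  then show ?thesis
    by (subst (1 2) det_col[of _ n]) (simp_all add: sum_distrib_right)
qed

text \<open>The eigenvectors of the path are orthogonal by the Christoffel--Darboux identity, whose
  boundary term vanishes at the eigenvalues.\<close>

lemma eig_christoffel_darboux: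
  fixes c d :: "'a::comm_ring_1"
  shows "(c - d) * (\<Sum>i<n. eig c i * eig d i) = 
    (if n = 0 then 0 else eig c n * eig d (n - 1) - eig c (n - 1) * eig d n)"
proof (induction n)
  case (Suc n)
  show ?case
  proof (cases n)
    case (Suc m)
    then show ?thesis using Suc.IH by (simp add: algebra_simps)
  qed simp
qed simp

text \<open>By orthogonality the Gram matrix is diagonal. Over the reals its entries are sums of
  squares, positive because \<open>eig\<close> starts with 1.\<close>

lemma det_eig_nonzero:
  fixes x :: "nat \<Rightarrow> real"
  assumes k: "k > 0" and x: "\<And>c. c < k \<Longrightarrow> eig (x c) k = eig (x c) (k - 1)"
    and inj: "inj_on x {..<k}"
  shows "det (mat k k (\<lambda>(i, c). eig (x c) i)) \<noteq> 0"
proof -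
  let ?K = "mat k k (\<lambda>(i, c). eig (x c) i)"
  let ?G = "?K\<^sup>T * ?K"
  have G: "?G \<in> carrier_mat k k" by (rule mult_carrier_mat[of _ k k]) auto
  have G_eq: "?G $$ (c, d) = (\<Sum>i<k. eig (x c) i * eig (x d) i)" if "c < k" "d < k" for c d
    using that by (simp add: scalar_prod_def atLeast0LessThan)
  have off: "?G $$ (c, d) = 0" if "c < k" "d < k" "c \<noteq> d" for c d
  proof -
    have "(x c - x d) * ?G $$ (c, d) = 0"
      unfolding G_eq[OF that(1,2)] eig_christoffel_darboux
      using x[OF that(1)] x[OF that(2)] k by simp
    moreover have "x c \<noteq> x d" using inj that by (auto simp: inj_on_def)
    ultimately show ?thesis by simp
  qed
  have "?G $$ (c, c) > 0" if "c < k" for c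
  proof -
    have "0 < (\<Sum>i<k. eig (x c) i * eig (x c) i)"
      by (rule sum_pos2[of _ 0]) (use k in auto)
    then show ?thesis using G_eq[OF that that] by simp
  qed
  then have "0 \<notin> set (diag_mat ?G)" by (force simp: diag_mat_def)
  moreover have "upper_triangular ?G" using off by (intro upper_triangularI) auto
  ultimately have "det ?G \<noteq> 0" using upper_triangular_imp_det_eq_0_iff[OF G] by blast
  moreover have "det ?G = det (?K\<^sup>T) * det ?K" by (rule det_mult[of _ k]) auto
  ultimately show ?thesis by auto
qed

text \<open>After scaling out the Chebyshev value of each column, the determinant left on the right
  no longer depends on \<open>n\<close>.\<close>

lemma s_grid_mult_det:
  fixes x :: "nat \<Rightarrow> real"
  assumes k: "k > 1" "odd k" and n: "n > 0"
    and x: "\<And>c. c < k \<Longrightarrow> eig (x c) k = eig (x c) (k - 1)" and x2: "x (k - 1) = 2"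
  shows "real (s_grid k n) * det (mat k k (\<lambda>(i, c). eig (x c) i)) =
    det (mat (k - 1) (k - 1) (\<lambda>(i, c). eig (x c) i * (2 - x c))) * (\<Prod>c<k - 1. cheb (4 - x c) n)"
proof -
  define m where "m = k - 1"
  have km: "k = Suc m" using k by (simp add: m_def)
  define W where "W v c = grid_vec k (x c) v" for v c
  let ?N = "k * n"
  have kN: "k \<le> ?N" using n by simp
  have dec: "v = k * (v div k) + v mod k" "v mod k < k" for v using k by simp_all
  have W: "(\<Sum>u\<in>grid_nb k n v. W v c - W u c) =
     (if v + k < ?N then 0 else eig (x c) (v mod k) * ((2 - x c) * cheb (4 - x c) n))"
    if "v < ?N" "c < k" for v c
  proof -
    have j: "v div k < n" using that k by (simp add: less_mult_imp_div_less mult.commute)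
    have "v + k < ?N \<longleftrightarrow> Suc (v div k) < n"
    proof
      assume "v + k < ?N"
      then have "(v + k) div k < n" by (simp add: less_mult_imp_div_less mult.commute)
      then show "Suc (v div k) < n" using k by simp
    next
      assume "Suc (v div k) < n"
      then have "k * Suc (Suc (v div k)) \<le> ?N" by (intro mult_le_mono2) simp
      moreover have "k * Suc (Suc (v div k)) = k * (v div k) + k + k" by simp
      ultimately show "v + k < ?N" using dec(1)[of v] dec(2)[of v] by linarith
    qed
    then show ?thesis
      unfolding W_def using grid_vec_harmonic[OF k(1) x[OF that(2)] dec(2)[of v] j] by simp
  qed
  have lap: "det (rooted_laplacian ?N (grid_nb k n) (?N - 1)) * det (mat k k (\<lambda>(v, c). W v c)) =
    det (mat k k (\<lambda>(i, c). if i = k - 1 then W (?N - 1) c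
      else \<Sum>u\<in>grid_nb k n (?N - k + i). W (?N - k + i) c - W u c))"
  proof (rule det_rooted_laplacian_banded[OF kN k(2)])
    show "grid_nb k n v \<subseteq> {0..<?N}" if "v < ?N" for v using grid_nb_subset[OF that] .
    show "u \<le> v + k" if "u \<in> grid_nb k n v" for v u
      using that k by (auto simp: grid_nb_def split: if_splits)
    show "v + k \<in> grid_nb k n v" if "v + k < ?N" for v
      using that by (simp add: grid_nb_def)
    show "(\<Sum>u\<in>grid_nb k n v. W v c - W u c) = 0" if "v + k < ?N" "c < k" for v c
      using W[of v c] that by simp
  qed
  have top: "mat k k (\<lambda>(v, c). W v c) = mat k k (\<lambda>(i, c). eig (x c) i)"
    by (rule eq_matI) (auto simp: W_def grid_vec_def grid_factor_def)
  \<comment> \<open>The last column belongs to the parameter 2: the factor \<open>2 - c\<close>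
    makes it vanish above the root row, and the constant eigenvector puts 1 into the corner.\<close>
  have bottom: "mat k k (\<lambda>(i, c). if i = k - 1 then W (?N - 1) c
      else \<Sum>u\<in>grid_nb k n (?N - k + i). W (?N - k + i) c - W u c) =
    four_block_mat (mat m m (\<lambda>(i, c). eig (x c) i * (2 - x c) * cheb (4 - x c) n)) (0\<^sub>m m 1)
      (mat 1 m (\<lambda>(i, c). W (?N - 1) c)) (mat 1 1 (\<lambda>_. 1))" (is "?L = ?R")
  proof (rule eq_matI)
    fix i c assume "i < dim_row ?R" "c < dim_col ?R"
    then have ic: "i < k" "c < k" using km by auto
    obtain q where "?N = k + q" using kN le_Suc_ex by blast
    then have iN: "?N - k + i < ?N" "\<not> ?N - k + i + k < ?N" using ic(1) by simp_all
    have "?N - k = k * (n - 1)" using n by (cases n) auto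
    then have mod: "(?N - k + i) mod k = i" using ic by simp
    obtain n' where n': "n = Suc n'" using n by (cases n) auto
    have xm: "x m = 2" using x2 by (simp add: m_def)
    have "?N - 1 = k * n' + m" "m < k" using km n' by simp_all
    then have "(?N - 1) mod k = m" "(?N - 1) div k = n'" by simp_all
    then have corner: "W (?N - 1) m = 1"
      by (simp add: W_def grid_vec_def eig_2 grid_factor_def cheb_2 xm)
    have "(\<Sum>u\<in>grid_nb k n (?N - k + i). W (?N - k + i) c - W u c) =
        eig (x c) i * ((2 - x c) * cheb (4 - x c) n)"
      using W[OF iN(1) ic(2)] iN(2) mod by simp
    then have "?L $$ (i, c) = (if i = m then W (?N - 1) c
        else eig (x c) i * ((2 - x c) * cheb (4 - x c) n))"
      using ic by (simp add: m_def)
    also have "\<dots> = ?R $$ (i, c)"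
      using ic corner xm by (cases "i = m"; cases "c = m") (auto simp: km mult.assoc)
    finally show "?L $$ (i, c) = ?R $$ (i, c)" .
  qed (simp_all add: km)
  have "real (s_grid k n) * det (mat k k (\<lambda>(i, c). eig (x c) i)) =
      det (rooted_laplacian ?N (grid_nb k n) (?N - 1)) * det (mat k k (\<lambda>(v, c). W v c))"
    unfolding top using s_grid_eq_det[of k n, where 'a = real] k n by simp
  also have "\<dots> = det (mat m m (\<lambda>(i, c). eig (x c) i * (2 - x c) * cheb (4 - x c) n)) *
      det (mat 1 1 (\<lambda>_. 1))"
    unfolding lap bottom by (rule det_four_block_mat_upper_right_zero_col) auto
  also have "det (mat 1 1 (\<lambda>_. 1 :: real)) = 1" by (subst det_single) auto
  finally show ?thesis by (simp add: m_def det_scale_columns)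
qed

text \<open>A single column is a path, hence banded with width 1, and the constant function 1 serves
  as \<open>W\<close>.\<close>

lemma s_grid_1:
  assumes "k > 0"
  shows "s_grid k 1 = 1"
proof -
  have "det (rooted_laplacian k (grid_nb k 1) (k - 1)) * det (mat 1 1 (\<lambda>(v, c). 1 :: real)) =
    det (mat 1 1 (\<lambda>(i, c). if i = 1 - 1 then 1
      else \<Sum>u\<in>grid_nb k 1 (k - 1 + i). (1::real) - 1))"
  proof (rule det_rooted_laplacian_banded)
    show "grid_nb k 1 v \<subseteq> {0..<k}" if "v < k" for v
      using grid_nb_subset[of v k 1] that by simp
    show "u \<le> v + 1" if "u \<in> grid_nb k 1 v" for u v
      using that by (auto simp: grid_nb_def split: if_splits)
    show "v + 1 \<in> grid_nb k 1 v" if "v + 1 < k" for v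
      using that by (auto simp: grid_nb_def)
  qed (use assms in auto)
  then have "real (s_grid k 1) = 1"
    using s_grid_eq_det[of k 1, where 'a = real] assms by (simp add: det_single)
  then show ?thesis by simp
qed

text \<open>At \<open>n = 1\<close> the tree count and all Chebyshev values are 1, which identifies
  the remaining determinant with \<open>?D\<close>. For general \<open>n\<close> the nonzero
  \<open>?D\<close> then cancels.\<close>

theorem s_grid_eq_prod:
  fixes x :: "nat \<Rightarrow> real"
  assumes k: "k > 1" "odd k"
    and x: "\<And>c. c < k \<Longrightarrow> eig (x c) k = eig (x c) (k - 1)" and x2: "x (k - 1) = 2"
    and inj: "inj_on x {..<k}"
  shows "real (s_grid k n) = (\<Prod>c<k - 1. cheb (4 - x c) n)"
proof (cases "n = 0")
  case True
  have "(0::real) ^ (k - 1) = 0" using k by simp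
  then show ?thesis using True by (simp add: s_grid_def)
next
  case False
  let ?D = "det (mat k k (\<lambda>(i, c). eig (x c) i))"
  have "real (s_grid k 1) * ?D = det (mat (k - 1) (k - 1) (\<lambda>(i, c). eig (x c) i * (2 - x c)))"
    using s_grid_mult_det[of k 1 x] k x x2 by simp
  then have "det (mat (k - 1) (k - 1) (\<lambda>(i, c). eig (x c) i * (2 - x c))) = ?D"
    using s_grid_1[of k] k by simp
  then have "real (s_grid k n) * ?D = ?D * (\<Prod>c<k - 1. cheb (4 - x c) n)"
    using s_grid_mult_det[of k n x] k x x2 False by simp
  moreover have "?D \<noteq> 0" using det_eig_nonzero[of k x] k x inj by simp
  ultimately show ?thesis by simp
qed

section \<open>The eigenvalues of the path on seven vertices\<close>

lemma path7_eigenvalues: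
  obtains a b d :: real
  where "a + b + d = 1" "a * b + a * d + b * d = -2" "a * b * d = -1"
    "distinct [a, b, d, -a, -b, -d, 2]"
proof -
  let ?f = "\<lambda>x::real. x ^ 3 - x ^ 2 - 2 * x + 1"
  have "\<exists>x\<ge>9/5. x \<le> 181/100 \<and> ?f x = 0"
    by (rule IVT) (auto simp: power3_eq_cube power2_eq_square intro!: continuous_intros)
  then obtain a where a: "9/5 \<le> a" "a \<le> 181/100" "?f a = 0" by blast
  \<comment> \<open>With \<open>a\<close> = 2 cos (pi/7), doubling the angle gives \<open>-b\<close>
    = 2 cos (2 pi/7). The third root, 2 cos (3 pi/7), follows from the sum of the roots being 1. The
    rational bounds below separate all seven numbers.\<close>
  define b where "b = 2 - a\<^sup>2"
  define d where "d = a\<^sup>2 - a - 1"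
  have "(9/5) * (9/5) \<le> a * a" "a * a \<le> (181/100) * (181/100)"
    using a by (intro mult_mono; simp)+
  then have bnds: "-13/10 < b" "b < -6/5" "3/10 < d" "d < 1/2"
    using a by (simp_all add: b_def d_def power2_eq_square)
  have a3: "a ^ 3 = a ^ 2 + 2 * a - 1" using a(3) by simp
  show thesis
  proof
    show "a + b + d = 1" by (simp add: b_def d_def)
    show "a * b + a * d + b * d = -2" unfolding b_def d_def using a3 by Groebner_Basis.algebra
    show "a * b * d = -1" unfolding b_def d_def using a3 by Groebner_Basis.algebra
    show "distinct [a, b, d, -a, -b, -d, 2]" using a bnds by auto
  qed
qed

text \<open>The second cubic is, up to sign, the first at \<open>-c\<close>, so its roots are the
  negatives of the first three.\<close>

lemma eig_7:
  fixes c :: "'a::comm_ring_1"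
  shows "eig c 7 - eig c 6 = (c - 2) * ((c ^ 3 - c ^ 2 - 2 * c + 1) * (c ^ 3 + c ^ 2 - 2 * c - 1))"
  by (simp add: numeral_eq_Suc algebra_simps)

lemma s_grid_7_eq_prod:
  fixes a b d :: real
  assumes e: "a + b + d = 1" "a * b + a * d + b * d = -2" "a * b * d = -1"
    and dist: "distinct [a, b, d, -a, -b, -d, 2]"
  shows "real (s_grid 7 n) = (cheb (4 - a) n * cheb (4 - b) n * cheb (4 - d) n) *
    (cheb (4 + a) n * cheb (4 + b) n * cheb (4 + d) n)"
proof -
  \<comment> \<open>The parameter 2 comes last, as \<open>s_grid_eq_prod\<close> demands.\<close>
  let ?l = "[a, b, d, -a, -b, -d, 2]"
  let ?x = "\<lambda>c. ?l ! c"
  have root: "c ^ 3 - c ^ 2 - 2 * c + 1 = 0" if "c \<in> {a, b, d}" for c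
    using that e by auto Groebner_Basis.algebra+
  have "eig c 7 = eig c (7 - 1)" if c: "c \<in> set ?l" for c
  proof -
    consider "c = 2" | "c \<in> {a, b, d}" | "- c \<in> {a, b, d}" using c by auto
    then have "eig c 7 - eig c 6 = 0"
      unfolding eig_7
    proof cases
      case 3
      have "c ^ 3 + c ^ 2 - 2 * c - 1 = 0" using root[OF 3] by simp
      then show "(c - 2) * ((c ^ 3 - c ^ 2 - 2 * c + 1) * (c ^ 3 + c ^ 2 - 2 * c - 1)) = 0" by simp
    qed (simp_all add: root)
    then show ?thesis by simp
  qed
  then have x: "eig (?x c) 7 = eig (?x c) (7 - 1)" if "c < 7" for c
    using that nth_mem[of c ?l] by simp
  have inj: "inj_on ?x {..<7}"
    using inj_on_nth[OF dist, of "{..<7}"] by simp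
  have "real (s_grid 7 n) = (\<Prod>c<7 - 1. cheb (4 - ?x c) n)"
    by (rule s_grid_eq_prod[OF _ _ x _ inj]) auto
  also have "\<dots> = (\<Prod>c\<leftarrow>[a, b, d, -a, -b, -d]. cheb (4 - c) n)"
    by (simp add: numeral_eq_Suc lessThan_Suc)
  finally show ?thesis by (simp add: algebra_simps)
qed

section \<open>Recurrences for products of Chebyshev sequences\<close>

text \<open>If \<open>x = \<xi> + 1/\<xi>\<close>, \<open>y = \<eta> + 1/\<eta>\<close>, \<open>z = \<zeta> + 1/\<zeta>\<close>, then the roots of the characteristic
  polynomial are the eight products of one of \<open>\<xi>, 1/\<xi>\<close>, one of \<open>\<eta>, 1/\<eta>\<close> and one of
  \<open>\<zeta>, 1/\<zeta>\<close>. Expressing all terms by the values at \<open>n + 4\<close> and \<open>n + 5\<close> keeps the degrees low.\<close>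

lemma cheb_triple_recurrence:
  fixes x y z :: "'a::idom"
  defines "T n \<equiv> cheb x n * cheb y n * cheb z n"
  shows "T (n + 8) + T n - x * y * z * (T (n + 7) + T (n + 1)) +
    (x\<^sup>2 * y\<^sup>2 + y\<^sup>2 * z\<^sup>2 + z\<^sup>2 * x\<^sup>2 - 2 * (x\<^sup>2 + y\<^sup>2 + z\<^sup>2) + 4) * (T (n + 6) + T (n + 2)) -
    x * y * z * (x\<^sup>2 + y\<^sup>2 + z\<^sup>2 - 5) * (T (n + 5) + T (n + 3)) +
    (x ^ 4 + y ^ 4 + z ^ 4 + x\<^sup>2 * y\<^sup>2 * z\<^sup>2 - 4 * (x\<^sup>2 + y\<^sup>2 + z\<^sup>2) + 6) * T (n + 4) = 0"
proof -
  have centred: "cheb t (n + 3) = t * cheb t (n + 4) - cheb t (n + 5)"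
    "cheb t (n + 2) = (t\<^sup>2 - 1) * cheb t (n + 4) - t * cheb t (n + 5)"
    "cheb t (n + 1) = (t ^ 3 - 2 * t) * cheb t (n + 4) - (t\<^sup>2 - 1) * cheb t (n + 5)"
    "cheb t n = (t ^ 4 - 3 * t\<^sup>2 + 1) * cheb t (n + 4) - (t ^ 3 - 2 * t) * cheb t (n + 5)"
    "cheb t (n + 6) = t * cheb t (n + 5) - cheb t (n + 4)"
    "cheb t (n + 7) = (t\<^sup>2 - 1) * cheb t (n + 5) - t * cheb t (n + 4)"
    "cheb t (n + 8) = (t ^ 3 - 2 * t) * cheb t (n + 5) - (t\<^sup>2 - 1) * cheb t (n + 4)" for t :: 'a
  proof -
    have step: "cheb t (m + 2) = t * cheb t (m + 1) - cheb t m" for m by simp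
    have s: "cheb t (n + 2) = t * cheb t (n + 1) - cheb t n"
      "cheb t (n + 3) = t * cheb t (n + 2) - cheb t (n + 1)"
      "cheb t (n + 4) = t * cheb t (n + 3) - cheb t (n + 2)"
      "cheb t (n + 5) = t * cheb t (n + 4) - cheb t (n + 3)"
      "cheb t (n + 6) = t * cheb t (n + 5) - cheb t (n + 4)"
      "cheb t (n + 7) = t * cheb t (n + 6) - cheb t (n + 5)"
      "cheb t (n + 8) = t * cheb t (n + 7) - cheb t (n + 6)"
      using step[of n] step[of "n + 1"] step[of "n + 2"] step[of "n + 3"]
        step[of "n + 4"] step[of "n + 5"] step[of "n + 6"] by (simp_all add: numeral_eq_Suc)
    from s show "cheb t (n + 3) = t * cheb t (n + 4) - cheb t (n + 5)"
      "cheb t (n + 2) = (t\<^sup>2 - 1) * cheb t (n + 4) - t * cheb t (n + 5)"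
      "cheb t (n + 1) = (t ^ 3 - 2 * t) * cheb t (n + 4) - (t\<^sup>2 - 1) * cheb t (n + 5)"
      "cheb t n = (t ^ 4 - 3 * t\<^sup>2 + 1) * cheb t (n + 4) - (t ^ 3 - 2 * t) * cheb t (n + 5)"
      "cheb t (n + 6) = t * cheb t (n + 5) - cheb t (n + 4)"
      "cheb t (n + 7) = (t\<^sup>2 - 1) * cheb t (n + 5) - t * cheb t (n + 4)"
      "cheb t (n + 8) = (t ^ 3 - 2 * t) * cheb t (n + 5) - (t\<^sup>2 - 1) * cheb t (n + 4)"
      by Groebner_Basis.algebra+
  qed
  show ?thesis
    unfolding T_def centred[of x] centred[of y] centred[of z] by Groebner_Basis.algebra
qed

text \<open>The norm form of the cubic \<open>t\<^sup>3 - t\<^sup>2 - 2 * t + 1\<close> with roots \<open>a, b, d\<close>.\<close>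

lemma cubic_norm:
  fixes a b d :: "'a::idom"
  assumes "a + b + d = 1" "a * b + a * d + b * d = -2" "a * b * d = -1"
  shows "(u + v * a + w * a\<^sup>2) * (u + v * b + w * b\<^sup>2) * (u + v * d + w * d\<^sup>2) =
    u ^ 3 + u\<^sup>2 * v + 5 * u\<^sup>2 * w - 2 * u * v\<^sup>2 + u * v * w + 6 * u * w\<^sup>2 - v ^ 3 - v\<^sup>2 * w +
    2 * v * w\<^sup>2 + w ^ 3"
  using assms by Groebner_Basis.algebra

text \<open>Reducing modulo the cubic to degree at most 2 gives the shape to which
  \<open>cubic_norm\<close> applies.\<close>

lemma cheb_minus_root:
  fixes r :: "'a::idom"
  assumes r: "r ^ 3 = r\<^sup>2 + 2 * r - 1"
  shows "cheb (4 - r) 2 = 4 - r"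
    "cheb (4 - r) 3 = 15 - 8 * r + r\<^sup>2"
    "cheb (4 - r) 4 = 57 - 48 * r + 11 * r\<^sup>2"
    "cheb (4 - r) 5 = 224 - 263 * r + 80 * r\<^sup>2"
    "cheb (4 - r) 6 = 919 - 1388 * r + 492 * r\<^sup>2"
    "cheb (4 - r) 7 = 3944 - 7192 * r + 2784 * r\<^sup>2"
proof -
  let ?c = "cheb (4 - r)"
  have rec: "?c 2 = 4 - r" "?c 3 = (4 - r) * ?c 2 - 1" "?c 4 = (4 - r) * ?c 3 - ?c 2"
    "?c 5 = (4 - r) * ?c 4 - ?c 3" "?c 6 = (4 - r) * ?c 5 - ?c 4" "?c 7 = (4 - r) * ?c 6 - ?c 5"
    by (simp_all add: numeral_eq_Suc)
  show c2: "cheb (4 - r) 2 = 4 - r"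
    unfolding rec(1) by simp
  show c3: "cheb (4 - r) 3 = 15 - 8 * r + r\<^sup>2"
    unfolding rec(2) c2 by (simp add: power2_eq_square algebra_simps)
  show c4: "cheb (4 - r) 4 = 57 - 48 * r + 11 * r\<^sup>2"
    unfolding rec(3) c3 c2 using r by Groebner_Basis.algebra
  show c5: "cheb (4 - r) 5 = 224 - 263 * r + 80 * r\<^sup>2"
    unfolding rec(4) c4 c3 using r by Groebner_Basis.algebra
  show c6: "cheb (4 - r) 6 = 919 - 1388 * r + 492 * r\<^sup>2"
    unfolding rec(5) c5 c4 using r by Groebner_Basis.algebra
  show c7: "cheb (4 - r) 7 = 3944 - 7192 * r + 2784 * r\<^sup>2"
    unfolding rec(6) c6 c5 using r by Groebner_Basis.algebra
qed

lemma cheb_plus_root: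
  fixes r :: "'a::idom"
  assumes r: "r ^ 3 = r\<^sup>2 + 2 * r - 1"
  shows "cheb (4 + r) 2 = 4 + r"
    "cheb (4 + r) 3 = 15 + 8 * r + r\<^sup>2"
    "cheb (4 + r) 4 = 55 + 48 * r + 13 * r\<^sup>2"
    "cheb (4 + r) 5 = 192 + 265 * r + 112 * r\<^sup>2"
    "cheb (4 + r) 6 = 601 + 1428 * r + 812 * r\<^sup>2"
    "cheb (4 + r) 7 = 1400 + 7672 * r + 5376 * r\<^sup>2"
proof -
  let ?c = "cheb (4 + r)"
  have rec: "?c 2 = 4 + r" "?c 3 = (4 + r) * ?c 2 - 1" "?c 4 = (4 + r) * ?c 3 - ?c 2"
    "?c 5 = (4 + r) * ?c 4 - ?c 3" "?c 6 = (4 + r) * ?c 5 - ?c 4" "?c 7 = (4 + r) * ?c 6 - ?c 5"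
    by (simp_all add: numeral_eq_Suc)
  show c2: "cheb (4 + r) 2 = 4 + r"
    unfolding rec(1) by simp
  show c3: "cheb (4 + r) 3 = 15 + 8 * r + r\<^sup>2"
    unfolding rec(2) c2 by (simp add: power2_eq_square algebra_simps)
  show c4: "cheb (4 + r) 4 = 55 + 48 * r + 13 * r\<^sup>2"
    unfolding rec(3) c3 c2 using r by Groebner_Basis.algebra
  show c5: "cheb (4 + r) 5 = 192 + 265 * r + 112 * r\<^sup>2"
    unfolding rec(4) c4 c3 using r by Groebner_Basis.algebra
  show c6: "cheb (4 + r) 6 = 601 + 1428 * r + 812 * r\<^sup>2"
    unfolding rec(5) c5 c4 using r by Groebner_Basis.algebra
  show c7: "cheb (4 + r) 7 = 1400 + 7672 * r + 5376 * r\<^sup>2"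
    unfolding rec(6) c6 c5 using r by Groebner_Basis.algebra
qed

text \<open>Each value is a norm from the cubic field. The terms 6 and 7 lie beyond the window of
  length 6; they start the proof of its recurrence.\<close>

lemma cheb_minus_values:
  fixes a b d :: "'a::idom"
  assumes e: "a + b + d = 1" "a * b + a * d + b * d = -2" "a * b * d = -1"
  defines "w n \<equiv> cheb (4 - a) n * cheb (4 - b) n * cheb (4 - d) n"
  shows "w 0 = 0" "w 1 = 1" "w 2 = 41" "w 3 = 1183" "w 4 = 31529" "w 5 = 817991" "w 6 = 21001799" "w 7 = 536948224"
proof -
  have r: "a ^ 3 = a\<^sup>2 + 2 * a - 1" "b ^ 3 = b\<^sup>2 + 2 * b - 1" "d ^ 3 = d\<^sup>2 + 2 * d - 1"
    using e by Groebner_Basis.algebra+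
  show "w 0 = 0" "w 1 = 1" by (simp_all add: w_def)
  note t = cheb_minus_root[OF r(1)] cheb_minus_root[OF r(2)] cheb_minus_root[OF r(3)]
  show "w 2 = 41"
    using cubic_norm[OF e, of "4" "-1" "0"] by (simp add: w_def t)
  show "w 3 = 1183"
    using cubic_norm[OF e, of "15" "-8" "1"] by (simp add: w_def t)
  show "w 4 = 31529"
    using cubic_norm[OF e, of "57" "-48" "11"] by (simp add: w_def t)
  show "w 5 = 817991"
    using cubic_norm[OF e, of "224" "-263" "80"] by (simp add: w_def t)
  show "w 6 = 21001799"
    using cubic_norm[OF e, of "919" "-1388" "492"] by (simp add: w_def t)
  show "w 7 = 536948224"
    using cubic_norm[OF e, of "3944" "-7192" "2784"] by (simp add: w_def t)
qed

lemma cheb_plus_values: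
  fixes a b d :: "'a::idom"
  assumes e: "a + b + d = 1" "a * b + a * d + b * d = -2" "a * b * d = -1"
  defines "w n \<equiv> cheb (4 + a) n * cheb (4 + b) n * cheb (4 + d) n"
  shows "w 0 = 0" "w 1 = 1" "w 2 = 71" "w 3 = 4031" "w 4 = 222727" "w 5 = 12251959" "w 6 = 673430953" "w 7 = 37009842688"
proof -
  have r: "a ^ 3 = a\<^sup>2 + 2 * a - 1" "b ^ 3 = b\<^sup>2 + 2 * b - 1" "d ^ 3 = d\<^sup>2 + 2 * d - 1"
    using e by Groebner_Basis.algebra+
  show "w 0 = 0" "w 1 = 1" by (simp_all add: w_def)
  note t = cheb_plus_root[OF r(1)] cheb_plus_root[OF r(2)] cheb_plus_root[OF r(3)]
  show "w 2 = 71"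
    using cubic_norm[OF e, of "4" "1" "0"] by (simp add: w_def t)
  show "w 3 = 4031"
    using cubic_norm[OF e, of "15" "8" "1"] by (simp add: w_def t)
  show "w 4 = 222727"
    using cubic_norm[OF e, of "55" "48" "13"] by (simp add: w_def t)
  show "w 5 = 12251959"
    using cubic_norm[OF e, of "192" "265" "112"] by (simp add: w_def t)
  show "w 6 = 673430953"
    using cubic_norm[OF e, of "601" "1428" "812"] by (simp add: w_def t)
  show "w 7 = 37009842688"
    using cubic_norm[OF e, of "1400" "7672" "5376"] by (simp add: w_def t)
qed

lemma cheb_plus_recurrence:
  fixes a b d :: "'a::idom"
  assumes e: "a + b + d = 1" "a * b + a * d + b * d = -2" "a * b * d = -1"
  defines "w n \<equiv> cheb (4 + a) n * cheb (4 + b) n * cheb (4 + d) n"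
  shows "w (n + 8) - 71 * w (n + 7) + 952 * w (n + 6) - 3976 * w (n + 5) + 6384 * w (n + 4) -
    3976 * w (n + 3) + 952 * w (n + 2) - 71 * w (n + 1) + w n = 0"
proof -
  let ?x = "4 + a" and ?y = "4 + b" and ?z = "4 + d"
  have 1: "?x * ?y * ?z = 71" using e by Groebner_Basis.algebra
  have 2: "?x\<^sup>2 + ?y\<^sup>2 + ?z\<^sup>2 = 61" using e by Groebner_Basis.algebra
  have 3: "?x\<^sup>2 * ?y\<^sup>2 + ?y\<^sup>2 * ?z\<^sup>2 + ?z\<^sup>2 * ?x\<^sup>2 = 1070" using e by Groebner_Basis.algebra
  have 4: "?x ^ 4 + ?y ^ 4 + ?z ^ 4 = 1581"
  proof -
    have "?x ^ 4 + ?y ^ 4 + ?z ^ 4 =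
        (?x\<^sup>2 + ?y\<^sup>2 + ?z\<^sup>2)\<^sup>2 - 2 * (?x\<^sup>2 * ?y\<^sup>2 + ?y\<^sup>2 * ?z\<^sup>2 + ?z\<^sup>2 * ?x\<^sup>2)"
      by Groebner_Basis.algebra
    then show ?thesis unfolding 2 3 by simp
  qed
  have 5: "?x\<^sup>2 * ?y\<^sup>2 * ?z\<^sup>2 = 5041"
    unfolding power_mult_distrib[symmetric] 1 by simp
  \<comment> \<open>The constants are 952 = 1070 - 2 * 61 + 4, 56 = 61 - 5 and 6384 = 1581 + 5041 -
    4 * 61 + 6.\<close>
  have "w (n + 8) + w n - 71 * (w (n + 7) + w (n + 1)) + 952 * (w (n + 6) + w (n + 2)) -
      71 * 56 * (w (n + 5) + w (n + 3)) + 6384 * w (n + 4) = 0"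
    using cheb_triple_recurrence[of ?x n ?y ?z] unfolding w_def[symmetric] 1 2 3 4 5 by simp
  then show ?thesis by (simp add: algebra_simps)
qed

text \<open>Here the characteristic polynomial of degree 8 has the factor \<open>(t - 1)\<^sup>2\<close>, which the initial
  values allow to remove.\<close>

lemma cheb_minus_recurrence:
  fixes a b d :: "'a::idom"
  assumes e: "a + b + d = 1" "a * b + a * d + b * d = -2" "a * b * d = -1"
  defines "w n \<equiv> cheb (4 - a) n * cheb (4 - b) n * cheb (4 - d) n"
  shows "w (n + 6) - 39 * w (n + 5) + 377 * w (n + 4) - 847 * w (n + 3) + 377 * w (n + 2) -
    39 * w (n + 1) + w n = 0"
proof -
  let ?x = "4 - a" and ?y = "4 - b" and ?z = "4 - d"
  have 1: "?x * ?y * ?z = 41" using e by Groebner_Basis.algebra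
  have 2: "?x\<^sup>2 + ?y\<^sup>2 + ?z\<^sup>2 = 45" using e by Groebner_Basis.algebra
  have 3: "?x\<^sup>2 * ?y\<^sup>2 + ?y\<^sup>2 * ?z\<^sup>2 + ?z\<^sup>2 * ?x\<^sup>2 = 542" using e by Groebner_Basis.algebra
  have 4: "?x ^ 4 + ?y ^ 4 + ?z ^ 4 = 941"
  proof -
    have "?x ^ 4 + ?y ^ 4 + ?z ^ 4 =
        (?x\<^sup>2 + ?y\<^sup>2 + ?z\<^sup>2)\<^sup>2 - 2 * (?x\<^sup>2 * ?y\<^sup>2 + ?y\<^sup>2 * ?z\<^sup>2 + ?z\<^sup>2 * ?x\<^sup>2)"
      by Groebner_Basis.algebra
    then show ?thesis unfolding 2 3 by simp
  qed
  have 5: "?x\<^sup>2 * ?y\<^sup>2 * ?z\<^sup>2 = 1681"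
    unfolding power_mult_distrib[symmetric] 1 by simp
  define R where "R n = w (n + 6) - 39 * w (n + 5) + 377 * w (n + 4) - 847 * w (n + 3) +
    377 * w (n + 2) - 39 * w (n + 1) + w n" for n
  have eight: "w (n + 8) + w n - 41 * (w (n + 7) + w (n + 1)) + 456 * (w (n + 6) + w (n + 2)) -
      41 * 40 * (w (n + 5) + w (n + 3)) + 2448 * w (n + 4) = 0" for n
    using cheb_triple_recurrence[of ?x n ?y ?z] unfolding w_def[symmetric] 1 2 3 4 5 by simp
  \<comment> \<open>The order 8 operator is the order 6 one followed by two differences, so
    \<open>R\<close> is an arithmetic progression and vanishes once \<open>R 0\<close> and
    \<open>R 1\<close> do.\<close>
  have step: "R (Suc (Suc n)) = 2 * R (Suc n) - R n" for n
    using eight[of n] by (simp add: R_def numeral_eq_Suc algebra_simps)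
  note v = cheb_minus_values[OF e, folded w_def]
  have "R n = 0 \<and> R (Suc n) = 0"
  proof (induction n)
    case 0
    show ?case using v by (simp add: R_def numeral_eq_Suc)
  qed (simp add: step)
  then show ?thesis by (simp add: R_def)
qed

section \<open>Products of two linear recurrences\<close>

text \<open>A matrix of integer coefficients represents a bilinear form in windows of two linearly
  recurrent sequences; shifting the windows acts on the coefficients by companion matrices.\<close>

fun lin :: "int list \<Rightarrow> (nat \<Rightarrow> 'a::comm_ring_1) \<Rightarrow> nat \<Rightarrow> 'a" where
  "lin [] f n = 0"
| "lin (x # xs) f n = of_int x * f n + lin xs f (Suc n)"

fun bilin :: "int list list \<Rightarrow> (nat \<Rightarrow> 'a::comm_ring_1) \<Rightarrow> (nat \<Rightarrow> 'a) \<Rightarrow> nat \<Rightarrow> nat \<Rightarrow> 'a" where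
  "bilin [] f g m n = 0"
| "bilin (r # rs) f g m n = f m * lin r g n + bilin rs f g (Suc m) n"

definition sub_scaled :: "int \<Rightarrow> int list \<Rightarrow> int list \<Rightarrow> int list" where
  "sub_scaled c xs ys = map2 (\<lambda>x y. x - c * y) xs ys"

text \<open>Multiplication by the variable modulo a monic polynomial whose lower coefficients,
  constant term first, are \<open>q\<close>: the overflowing top coefficient is folded back.\<close>

definition shift_row :: "int list \<Rightarrow> int list \<Rightarrow> int list" where
  "shift_row q r = sub_scaled (last r) (0 # butlast r) q"

definition shift_rows :: "int list \<Rightarrow> int list list \<Rightarrow> int list list" where
  "shift_rows p A = (let l = last A in
     map2 (\<lambda>r c. sub_scaled c r l) (map (\<lambda>_. 0) l # butlast A) p)"

fun add_corner :: "int \<Rightarrow> int list list \<Rightarrow> int list list" where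
  "add_corner d ((x # r) # A) = ((x + d) # r) # A"
| "add_corner d A = A"

text \<open>One Horner step: shift both windows, then add \<open>d\<close> times the product of
  their first terms.\<close>

definition shift_form :: "int list \<Rightarrow> int list \<Rightarrow> int \<Rightarrow> int list list \<Rightarrow> int list list" where
  "shift_form p q d A = add_corner d (shift_rows p (map (shift_row q) A))"

lemma lin_sub_scaled:
  "length xs = length ys \<Longrightarrow> lin (sub_scaled c xs ys) f n = lin xs f n - of_int c * lin ys f n"
  by (induction xs ys arbitrary: n rule: list_induct2) (simp_all add: sub_scaled_def algebra_simps)

lemma lin_snoc: "lin (xs @ [x]) f n = lin xs f n + of_int x * f (n + length xs)"
  by (induction xs arbitrary: n) (simp_all add: algebra_simps)

lemma lin_zero: "lin (map (\<lambda>_. 0) l) f n = 0"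
  by (induction l arbitrary: n) simp_all

lemma lin_shift_row:
  assumes "length r = length q" "r \<noteq> []" "g (n + length q) + lin q g n = 0"
  shows "lin (shift_row q r) g n = lin r g (Suc n)"
proof -
  obtain s x where r: "r = s @ [x]" using assms(2) by (metis append_butlast_last_id)
  have "g (n + length q) = - lin q g n" using assms(3) by (simp add: add_eq_0_iff2)
  then have g: "g (Suc (n + length s)) = - lin q g n"
    using assms(1) r by (metis add_Suc_right length_append_singleton)
  have "lin (shift_row q r) g n = lin (0 # s) g n - of_int x * lin q g n"
    unfolding shift_row_def r using assms(1) r by (subst lin_sub_scaled) simp_all
  also have "\<dots> = lin r g (Suc n)" unfolding r lin_snoc by (simp add: g)
  finally show ?thesis .
qed

lemma bilin_shift_row:
  assumes "\<And>r. r \<in> set A \<Longrightarrow> length r = length q" "q \<noteq> []" "g (n + length q) + lin q g n = 0"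
  shows "bilin (map (shift_row q) A) f g m n = bilin A f g m (Suc n)"
  using assms(1)
proof (induction A arbitrary: m)
  case (Cons r A)
  have "lin (shift_row q r) g n = lin r g (Suc n)"
    using Cons.prems[of r] assms by (intro lin_shift_row) auto
  then show ?case using Cons by simp
qed simp

text \<open>The matrix subtracted has rank one, so its form splits into a product of two linear
  forms.\<close>

lemma bilin_sub_scaled:
  assumes "length A = length p" "\<And>r. r \<in> set A \<Longrightarrow> length r = length l"
  shows "bilin (map2 (\<lambda>r c. sub_scaled c r l) A p) f g m n = bilin A f g m n - lin p f m * lin l g n"
  using assms
proof (induction A p arbitrary: m rule: list_induct2)
  case (Cons r A c p)
  have "bilin (map2 (\<lambda>r c. sub_scaled c r l) A p) f g (Suc m) n =
      bilin A f g (Suc m) n - lin p f (Suc m) * lin l g n"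
    using Cons.prems by (intro Cons.IH) simp
  moreover have "length r = length l" using Cons.prems by simp
  ultimately show ?case by (simp add: lin_sub_scaled algebra_simps)
qed simp

lemma bilin_snoc: "bilin (A @ [r]) f g m n = bilin A f g m n + f (m + length A) * lin r g n"
  by (induction A arbitrary: m) (simp_all add: algebra_simps)

lemma bilin_shift_rows:
  assumes "length A = length p" "A \<noteq> []" "\<And>r. r \<in> set A \<Longrightarrow> length r = k"
    "f (m + length p) + lin p f m = 0"
  shows "bilin (shift_rows p A) f g m n = bilin A f g (Suc m) n"
proof -
  obtain B l where A: "A = B @ [l]" using assms(2) by (metis append_butlast_last_id)
  have "f (m + length p) = - lin p f m" using assms(4) by (simp add: add_eq_0_iff2)
  then have f: "f (Suc (m + length B)) = - lin p f m" using assms(1) A by (metis add_Suc_right length_append_singleton)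
  have "shift_rows p A = map2 (\<lambda>r c. sub_scaled c r l) (map (\<lambda>_. 0) l # B) p"
    by (simp add: shift_rows_def A)
  moreover have "length r = length l" if "r \<in> set (map (\<lambda>_. 0) l # B)" for r
    using that assms(3)[of r] assms(3)[of l] A by auto
  ultimately have "bilin (shift_rows p A) f g m n =
      bilin (map (\<lambda>_. 0) l # B) f g m n - lin p f m * lin l g n"
    using bilin_sub_scaled[of "map (\<lambda>_. 0) l # B" p l f g m n] assms(1) A by simp
  also have "\<dots> = bilin A f g (Suc m) n" unfolding A bilin_snoc by (simp add: f lin_zero)
  finally show ?thesis .
qed

lemma bilin_add_corner:
  assumes "A \<noteq> []" "\<And>r. r \<in> set A \<Longrightarrow> r \<noteq> []"
  shows "bilin (add_corner d A) f g m n = bilin A f g m n + of_int d * (f m * g n)"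
  using assms by (cases "(d, A)" rule: add_corner.cases) (auto simp: algebra_simps)

text \<open>Since \<open>map2\<close> silently truncates to the shorter list, the shapes have to be
  carried through every step.\<close>

definition form_dims :: "nat \<Rightarrow> nat \<Rightarrow> int list list \<Rightarrow> bool" where
  "form_dims a b A \<longleftrightarrow> length A = a \<and> (\<forall>r\<in>set A. length r = b)"

lemma form_dims_add_corner: "form_dims a b (add_corner d A) \<longleftrightarrow> form_dims a b A"
  by (cases "(d, A)" rule: add_corner.cases) (auto simp: form_dims_def)

lemma form_dims_shift_row:
  assumes "form_dims a (length q) A" "q \<noteq> []"
  shows "form_dims a (length q) (map (shift_row q) A)"
  using assms by (auto simp: form_dims_def shift_row_def sub_scaled_def)

lemma form_dims_shift_rows:
  assumes "form_dims (length p) b A" "p \<noteq> []"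
  shows "form_dims (length p) b (shift_rows p A)"
proof -
  have ne: "A \<noteq> []" using assms by (auto simp: form_dims_def)
  have len: "length r = b" if "r \<in> set A" for r using assms that by (auto simp: form_dims_def)
  have "length r = b" if "r \<in> set (shift_rows p A)" for r
  proof -
    obtain r' c where "r = sub_scaled c r' (last A)" "r' \<in> set (map (\<lambda>_. 0) (last A) # butlast A)"
      using \<open>r \<in> set (shift_rows p A)\<close> unfolding shift_rows_def Let_def
      by (auto dest!: set_zip_leftD)
    moreover from this have "length r' = b"
      using len[OF last_in_set[OF ne]] len[OF in_set_butlastD[of r' A]] by auto
    ultimately show ?thesis using len[OF last_in_set[OF ne]] by (simp add: sub_scaled_def)
  qed
  moreover have "length (shift_rows p A) = length p"
    using assms ne by (simp add: shift_rows_def form_dims_def Let_def)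
  ultimately show ?thesis by (simp add: form_dims_def)
qed

lemma shift_form:
  fixes f g :: "nat \<Rightarrow> 'a::comm_ring_1"
  assumes A: "form_dims (length p) (length q) A" and ne: "p \<noteq> []" "q \<noteq> []"
    and f: "\<And>n. f (n + length p) + lin p f n = 0" and g: "\<And>n. g (n + length q) + lin q g n = 0"
  shows "form_dims (length p) (length q) (shift_form p q d A)"
    "bilin (shift_form p q d A) f g n n = bilin A f g (Suc n) (Suc n) + of_int d * (f n * g n)"
proof -
  let ?B = "map (shift_row q) A"
  let ?C = "shift_rows p ?B"
  have B: "form_dims (length p) (length q) ?B" using form_dims_shift_row[OF A ne(2)] .
  have C: "form_dims (length p) (length q) ?C" using form_dims_shift_rows[OF B ne(1)] .
  then show "form_dims (length p) (length q) (shift_form p q d A)"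
    by (simp add: shift_form_def form_dims_add_corner)
  have "bilin (shift_form p q d A) f g n n = bilin ?C f g n n + of_int d * (f n * g n)"
    unfolding shift_form_def using C ne by (intro bilin_add_corner) (auto simp: form_dims_def)
  also have "bilin ?C f g n n = bilin ?B f g (Suc n) n"
    using B ne f by (intro bilin_shift_rows[where k = "length q"]) (auto simp: form_dims_def)
  also have "\<dots> = bilin A f g (Suc n) (Suc n)"
    using A ne g by (intro bilin_shift_row) (auto simp: form_dims_def)
  finally show "bilin (shift_form p q d A) f g n n =
    bilin A f g (Suc n) (Suc n) + of_int d * (f n * g n)" .
qed

section \<open>Evaluation of forms at the initial windows and the Horner check\<close>

fun dot :: "int list \<Rightarrow> int list \<Rightarrow> int" where
  "dot (x # xs) (y # ys) = x * y + dot xs ys"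
| "dot _ _ = 0"

definition form_value :: "int list \<Rightarrow> int list \<Rightarrow> int list list \<Rightarrow> int" where
  "form_value us vs A = dot us (map (\<lambda>r. dot r vs) A)"

lemma lin_eq_dot:
  assumes "length xs = length vs" "\<And>i. i < length vs \<Longrightarrow> g (n + i) = of_int (vs ! i)"
  shows "lin xs g n = of_int (dot xs vs)"
  using assms
proof (induction xs vs arbitrary: n rule: list_induct2)
  case (Cons x xs v vs)
  have "g n = of_int v" using Cons.prems[of 0] by simp
  moreover have "lin xs g (Suc n) = of_int (dot xs vs)"
    using Cons.prems[of "Suc i" for i] by (intro Cons.IH) simp
  ultimately show ?case by simp
qed simp

lemma bilin_eq_form_value:
  assumes A: "form_dims (length us) (length vs) A"
    and f: "\<And>i. i < length us \<Longrightarrow> f i = of_int (us ! i)"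
    and g: "\<And>i. i < length vs \<Longrightarrow> g i = of_int (vs ! i)"
  shows "bilin A f g 0 0 = of_int (form_value us vs A)"
proof -
  have lin: "lin r g 0 = of_int (dot r vs)" if "length r = length vs" for r
    using that g by (intro lin_eq_dot) auto
  have "bilin A f g m 0 = of_int (dot us' (map (\<lambda>r. dot r vs) A))"
    if "length us' = length A" "\<And>i. i < length us' \<Longrightarrow> f (m + i) = of_int (us' ! i)"
      "\<And>r. r \<in> set A \<Longrightarrow> length r = length vs" for us' m
    using that
  proof (induction us' A arbitrary: m rule: list_induct2)
    case (Cons u us' r A)
    have "f m = of_int u" using Cons.prems(1)[of 0] by simp
    moreover have "bilin A f g (Suc m) 0 = of_int (dot us' (map (\<lambda>r. dot r vs) A))"
      using Cons.prems(1)[of "Suc i" for i] Cons.prems(2) by (intro Cons.IH) auto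
    ultimately show ?case using Cons.prems(2)[of r] lin[of r] by simp
  qed simp
  from this[of us 0] show ?thesis using A f by (auto simp: form_value_def form_dims_def)
qed

text \<open>Horner evaluation of a polynomial in the shift operator with coefficients \<^term>\<open>ds\<close>;
  the intermediate values at 0 are the Taylor coefficients of the numerator.\<close>

fun horner_check ::
  "int list \<Rightarrow> int list \<Rightarrow> int list \<Rightarrow> int list \<Rightarrow> int list list \<Rightarrow> int list \<Rightarrow> int list \<Rightarrow> bool" where
  "horner_check p q us vs A [] ns \<longleftrightarrow> ns = [] \<and> list_all (list_all (\<lambda>x. x = 0)) A"
| "horner_check p q us vs A (d # ds) ns \<longleftrightarrow> (case ns of [] \<Rightarrow> False | n # ns' \<Rightarrow>
     (let B = shift_form p q d A in form_value us vs B = n \<and> horner_check p q us vs B ds ns'))"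

lemma bilin_zero: "list_all (list_all (\<lambda>x. x = 0)) A \<Longrightarrow> bilin A f g m n = 0"
proof -
  have "lin r g n = 0" if "list_all (\<lambda>x. x = 0) r" for r n
    using that by (induction r arbitrary: n) simp_all
  then show "list_all (list_all (\<lambda>x. x = 0)) A \<Longrightarrow> bilin A f g m n = 0"
    by (induction A arbitrary: m) simp_all
qed

text \<open>\<open>G k\<close> stands for the Horner value after \<open>k\<close> coefficients,
  represented by the current form. Its values at 0 need only the initial windows, while a zero final
  form makes the last stage vanish for all \<open>n\<close>.\<close>

lemma horner_check_sound:
  fixes f g :: "nat \<Rightarrow> 'a::comm_ring_1" and G :: "nat \<Rightarrow> nat \<Rightarrow> 'a"
  assumes ne: "p \<noteq> []" "q \<noteq> []" and len: "length us = length p" "length vs = length q"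
    and f: "\<And>n. f (n + length p) + lin p f n = 0" and g: "\<And>n. g (n + length q) + lin q g n = 0"
    and us: "\<And>i. i < length us \<Longrightarrow> f i = of_int (us ! i)"
    and vs: "\<And>i. i < length vs \<Longrightarrow> g i = of_int (vs ! i)"
    and check: "horner_check p q us vs A ds ns" and A: "form_dims (length p) (length q) A"
    and G0: "\<And>n. G 0 n = bilin A f g n n"
    and G: "\<And>k n. k < length ds \<Longrightarrow> G (Suc k) n = G k (Suc n) + of_int (ds ! k) * (f n * g n)"
  shows "length ns = length ds" "\<And>k. k < length ds \<Longrightarrow> G (Suc k) 0 = of_int (ns ! k)"
    "\<And>n. G (length ds) n = 0"
proof -
  have "length ns = length ds \<and> (\<forall>k<length ds. G (Suc k) 0 = of_int (ns ! k)) \<and>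
      (\<forall>n. G (length ds) n = 0)"
    using check A G0 G
  proof (induction ds arbitrary: A ns G)
    case Nil
    then show ?case using bilin_zero by auto
  next
    case (Cons d ds)
    obtain n ns' where ns: "ns = n # ns'" using Cons.prems(1) by (cases ns) auto
    let ?B = "shift_form p q d A"
    have B: "form_dims (length p) (length q) ?B"
      "\<And>n. bilin ?B f g n n = bilin A f g (Suc n) (Suc n) + of_int d * (f n * g n)"
      using shift_form[OF Cons.prems(2) ne f g] by auto
    have G1: "G (Suc 0) m = bilin ?B f g m m" for m
      using Cons.prems(4)[of 0 m] Cons.prems(3) B(2) by simp
    have val: "form_value us vs ?B = n" and chk: "horner_check p q us vs ?B ds ns'"
      using Cons.prems(1) ns by (auto simp: Let_def)
    \<comment> \<open>The induction hypothesis is used for the family advanced by one stage, which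
      starts from \<open>?B\<close>.\<close>
    have "length ns' = length ds \<and> (\<forall>k<length ds. G (Suc (Suc k)) 0 = of_int (ns' ! k)) \<and>
        (\<forall>n. G (Suc (length ds)) n = 0)"
      using Cons.IH[OF chk B(1), of "\<lambda>k. G (Suc k)"] G1 Cons.prems(4)[of "Suc k" for k] by auto
    moreover have "G (Suc 0) 0 = of_int n"
      using G1[of 0] val bilin_eq_form_value[of us vs ?B f g] B(1) len us vs by simp
    ultimately show ?case using ns by (auto simp: less_Suc_eq_0_disj)
  qed
  then show "length ns = length ds" "\<And>k. k < length ds \<Longrightarrow> G (Suc k) 0 = of_int (ns ! k)"
    "\<And>n. G (length ds) n = 0" by auto
qed

text \<open>Ascending powers of t: the constant term of the denominator is the leading coefficient
  of the polynomial in the shift, so Horner evaluation consumes the list in this order.\<close>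

definition D7_coeffs :: "int list" where
  "D7_coeffs = [1, -2769, 2630641,
    -1195782497, 305993127089, -48551559344145,
    5083730101530753, -366971376492201338, 18871718211768417242,
    -709234610141846974874, 19874722637854592209338, -422023241997789381263002,
    6880098547452856483997402, -87057778313447181201990522, 862879164715733847737203343,
    -6750900711491569851736413311, 41958615314622858303912597215, -208258356862493902206466194607,
    828959040281722890327985220255, -2654944041424536277948746010303, 6859440538554030239641036025103,
    -14324708604336971207868317957868, 24214587194571650834572683444012, -33166490975387358866518005011884,
    36830850383375837481096026357868, -33166490975387358866518005011884, 24214587194571650834572683444012,
    -14324708604336971207868317957868, 6859440538554030239641036025103, -2654944041424536277948746010303,
    828959040281722890327985220255, -208258356862493902206466194607, 41958615314622858303912597215,
    -6750900711491569851736413311, 862879164715733847737203343, -87057778313447181201990522,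
    6880098547452856483997402, -422023241997789381263002, 19874722637854592209338,
    -709234610141846974874, 18871718211768417242, -366971376492201338,
    5083730101530753, -48551559344145, 305993127089,
    -1195782497, 2630641, -2769,
    1]"

text \<open>Padded by a final 0, as the check compares one value for each of the 49 coefficients of
  D7.\<close>

definition N7_coeffs :: "int list" where
  "N7_coeffs = [0, 1, 142,
    -661245, 279917500, -53184503243,
    5570891154842, -341638600598298, 11886702497030032,
    -164458937576610742, -4371158470492451828, 288737344956855301342,
    -7736513993329973661368, 131582338768322853956994, -1573202877300834187134466,
    13805721749199518460916737, -90975567796174070740787232, 455915282590547643587452175,
    -1747901867578637315747826286, 5126323837327170557921412877, -11416779122947828869806142972,
    18924703166237080216745900796, -22194247945745188489023284104, 15563815847174688069871470516,
    0, -15563815847174688069871470516, 22194247945745188489023284104,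
    -18924703166237080216745900796, 11416779122947828869806142972, -5126323837327170557921412877,
    1747901867578637315747826286, -455915282590547643587452175, 90975567796174070740787232,
    -13805721749199518460916737, 1573202877300834187134466, -131582338768322853956994,
    7736513993329973661368, -288737344956855301342, 4371158470492451828,
    164458937576610742, -11886702497030032, 341638600598298,
    -5570891154842, 53184503243, -279917500,
    661245, -142, -1,
    0]"

lemma horner_check_7:
  "horner_check [1, -39, 377, -847, 377, -39] [1, -71, 952, -3976, 6384, -3976, 952, -71]
    [0, 1, 41, 1183, 31529, 817991]
    [0, 1, 71, 4031, 222727, 12251959, 673430953, 37009842688]
    (replicate 6 (replicate 8 0)) D7_coeffs N7_coeffs"
  unfolding D7_coeffs_def N7_coeffs_def by code_simp

section \<open>The generating function\<close>

lemma s_grid_7_recurrence: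
  shows "k < length D7_coeffs \<Longrightarrow>
      (\<Sum>i<Suc k. D7_coeffs ! i * int (s_grid 7 (k - i))) = N7_coeffs ! k"
    and "(\<Sum>i<length D7_coeffs. D7_coeffs ! i * int (s_grid 7 (n + (length D7_coeffs - Suc i)))) = 0"
proof -
  obtain a b d :: real
    where e: "a + b + d = 1" "a * b + a * d + b * d = -2" "a * b * d = -1"
      and dist: "distinct [a, b, d, -a, -b, -d, 2]"
    using path7_eigenvalues .
  define f where "f n = cheb (4 - a) n * cheb (4 - b) n * cheb (4 - d) n" for n
  define g where "g n = cheb (4 + a) n * cheb (4 + b) n * cheb (4 + d) n" for n
  define s where "s n = real (s_grid 7 n)" for n
  have s: "s n = f n * g n" for n
    unfolding s_def f_def g_def by (rule s_grid_7_eq_prod[OF e dist])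
  let ?p = "[1, -39, 377, -847, 377, -39] :: int list" and ?q = "[1, -71, 952, -3976, 6384, -3976, 952, -71] :: int list"
  let ?us = "[0, 1, 41, 1183, 31529, 817991] :: int list"
  let ?vs = "[0, 1, 71, 4031, 222727, 12251959, 673430953, 37009842688] :: int list"
  let ?A = "replicate 6 (replicate 8 0)"
  note fv = cheb_minus_values[OF e, folded f_def] and gv = cheb_plus_values[OF e, folded g_def]
  have us: "f i = of_int (?us ! i)" if "i < length ?us" for i
    using that fv by (auto simp: less_Suc_eq numeral_eq_Suc)
  have vs: "g i = of_int (?vs ! i)" if "i < length ?vs" for i
    using that gv by (auto simp: less_Suc_eq numeral_eq_Suc)
  have f: "f (n + length ?p) + lin ?p f n = 0" for n
    using cheb_minus_recurrence[OF e, folded f_def, of n] by (simp add: numeral_eq_Suc)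
  have g: "g (n + length ?q) + lin ?q g n = 0" for n
    using cheb_plus_recurrence[OF e, folded g_def, of n] by (simp add: numeral_eq_Suc)
  \<comment> \<open>At \<open>n = 0\<close>, \<open>G (Suc k)\<close> is the coefficient of t^k in
    the product of D7 with the generating function.\<close>
  define G where "G k n = (\<Sum>i<k. of_int (D7_coeffs ! i) * s (n + (k - Suc i)))" for k n
  have G_Suc: "G (Suc k) n = G k (Suc n) + of_int (D7_coeffs ! k) * (f n * g n)" for k n
  proof -
    have "(\<Sum>i<k. of_int (D7_coeffs ! i) * s (n + (Suc k - Suc i))) = G k (Suc n)"
      unfolding G_def by (intro sum.cong) (auto simp: Suc_diff_Suc)
    then show ?thesis by (simp add: G_def s)
  qed
  have A: "form_dims (length ?p) (length ?q) ?A" by (simp add: form_dims_def)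
  have G_0: "G 0 n = bilin ?A f g n n" for n
    by (simp add: G_def bilin_zero list_all_iff)
  have ne: "?p \<noteq> []" "?q \<noteq> []" and len: "length ?us = length ?p" "length ?vs = length ?q"
    by simp_all
  note sound = horner_check_sound[OF ne len f g us vs horner_check_7 A G_0 G_Suc]
  show "(\<Sum>i<Suc k. D7_coeffs ! i * int (s_grid 7 (k - i))) = N7_coeffs ! k"
    if "k < length D7_coeffs"
  proof -
    \<comment> \<open>The factors \<open>f\<close> and \<open>g\<close> are known only as reals;
      injectivity of the embedding returns the identity to the integers.\<close>
    have "real_of_int (\<Sum>i<Suc k. D7_coeffs ! i * int (s_grid 7 (k - i))) = G (Suc k) 0"
      by (simp add: G_def s_def)
    also have "\<dots> = real_of_int (N7_coeffs ! k)" using that by (intro sound(2))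
    finally show ?thesis by (simp only: of_int_eq_iff)
  qed
  have "real_of_int (\<Sum>i<length D7_coeffs. D7_coeffs ! i *
      int (s_grid 7 (n + (length D7_coeffs - Suc i)))) = G (length D7_coeffs) n"
    by (simp add: G_def s_def)
  also have "\<dots> = real_of_int 0" using sound(3) by simp
  finally show "(\<Sum>i<length D7_coeffs. D7_coeffs ! i *
      int (s_grid 7 (n + (length D7_coeffs - Suc i)))) = 0"
    by (simp only: of_int_eq_iff)
qed

lemma D7_eq_sum: "D7 t = (\<Sum>i<49. of_int (D7_coeffs ! i) * t ^ i)" for t :: "'a::comm_ring_1"
  by (simp add: D7_def D7_coeffs_def lessThan_nat_numeral)

lemma N7_eq_sum: "N7 t = (\<Sum>i<49. of_int (N7_coeffs ! i) * t ^ i)" for t :: "'a::comm_ring_1"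
  by (simp add: N7_def N7_coeffs_def lessThan_nat_numeral)

lemma fps_nth_mult_sum_powers:
  fixes F :: "'a::comm_ring_1 fps"
  shows "fps_nth (F * (\<Sum>i<k. of_int (c i) * fps_X ^ i)) m =
    (\<Sum>i\<in>{i. i < k \<and> i \<le> m}. of_int (c i) * fps_nth F (m - i))"
proof -
  have "fps_nth (F * (of_int c * fps_X ^ i)) m = (if i \<le> m then of_int c * fps_nth F (m - i) else 0)"
    for c :: int and i
  proof -
    have "F * (of_int c * fps_X ^ i) = fps_const (of_int c) * (F * fps_X ^ i)"
      by (simp add: fps_of_int mult.left_commute)
    then show ?thesis by (simp add: fps_mult_left_const_nth fps_X_power_mult_right_nth)
  qed
  then show ?thesis
    by (simp add: sum_distrib_left fps_sum_nth sum.If_cases Int_def lessThan_def)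
qed

theorem theorem7:
  shows "Abs_fps (\<lambda>n. of_nat (s_grid 7 n) :: rat) = N7 fps_X / D7 fps_X"
proof -
  let ?F = "Abs_fps (\<lambda>n. of_nat (s_grid 7 n) :: rat)"
  have len: "length D7_coeffs = 49" by (simp add: D7_coeffs_def)
  have "?F * D7 fps_X = N7 fps_X"
  proof (rule fps_ext)
    fix m
    have F: "fps_nth (?F * D7 fps_X) m =
        of_int (\<Sum>i\<in>{i. i < 49 \<and> i \<le> m}. D7_coeffs ! i * int (s_grid 7 (m - i)))"
      unfolding D7_eq_sum fps_nth_mult_sum_powers by simp
    \<comment> \<open>The factor 1 lets the product formula extract the coefficients of N7
      itself.\<close>
    have "fps_nth (N7 fps_X :: rat fps) m = fps_nth (1 * N7 fps_X) m" by simp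
    also have "\<dots> = (\<Sum>i\<in>{i. i < 49 \<and> i \<le> m}. of_int (N7_coeffs ! i) * fps_nth 1 (m - i))"
      unfolding N7_eq_sum by (rule fps_nth_mult_sum_powers)
    also have "\<dots> = (\<Sum>i\<in>{i. i < 49 \<and> i \<le> m}. if i = m then of_int (N7_coeffs ! i) else 0)"
      by (intro sum.cong) auto
    also have "\<dots> = (if m < 49 then of_int (N7_coeffs ! m) else 0)"
      by (simp add: sum.delta)
    finally have N: "fps_nth (N7 fps_X :: rat fps) m = (if m < 49 then of_int (N7_coeffs ! m) else 0)" .
    show "fps_nth (?F * D7 fps_X) m = fps_nth (N7 fps_X) m"
    proof (cases "m < 49")
      case True
      then have "{i. i < 49 \<and> i \<le> m} = {..<Suc m}" by auto
      then show ?thesis unfolding F N using s_grid_7_recurrence(1)[of m] True len by simp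
    next
      case False
      then have "{i. i < 49 \<and> i \<le> m} = {..<49}" by auto
      moreover have "(\<Sum>i<49. D7_coeffs ! i * int (s_grid 7 (m - i))) =
          (\<Sum>i<49. D7_coeffs ! i * int (s_grid 7 (m - 48 + (49 - Suc i))))"
      proof (rule sum.cong)
        fix i :: nat assume "i \<in> {..<49}"
        \<comment> \<open>A window of 49 terms ending at \<open>m\<close> starts at
          \<open>m - 48\<close>.\<close>
        then have "m - i = m - 48 + (49 - Suc i)" using False by auto
        then show "D7_coeffs ! i * int (s_grid 7 (m - i)) =
            D7_coeffs ! i * int (s_grid 7 (m - 48 + (49 - Suc i)))" by (simp only:)
      qed simp
      ultimately show ?thesis
        unfolding F N using s_grid_7_recurrence(2)[of "m - 48"] False len by simp
    qed
  qed
  moreover have "D7 (fps_X :: rat fps) \<noteq> 0"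
  proof -
    have "{i::nat. i < 49 \<and> i \<le> 0} = {0}" by auto
    then have "fps_nth (1 * D7 (fps_X :: rat fps)) 0 = 1"
      unfolding D7_eq_sum fps_nth_mult_sum_powers by (simp add: D7_coeffs_def)
    then show ?thesis by auto
  qed
  ultimately show ?thesis by (metis nonzero_mult_div_cancel_right)
qed

end
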